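(* Let the setting and notation be as in the context, and let $r_n(t)=|\overline f_n(t)-e^{-t^2/2}|$. (i) Let $\gamma>0$ and either $\varepsilon\in(0,\infty]$ and $L^3=L_{E,n}^3(\varepsilon,\gamma)$, $p=p_E$, or $\varepsilon\in(0,\infty)$ and $L^3=L_{R,n}^3(\varepsilon,\gamma)$, $p=p_R$ (with $L>0$). Then for $L|t|<\overline\tau_0(\varepsilon)$, $$r_n(t)\le\Big(\exp\{L^3p(t,\varepsilon,\gamma)+L^4t^4B(L|t|,\varepsilon,L)\}-1\Big)e^{-t^2/2}.$$ In particular, for $L^3=L_{E,n}^3(\infty,\gamma)$ and $L|t|<2^{5/6}/\sqrt3=1.0287\ldots$, $$r_n(t)\le\Big(\exp\Big\{\tfrac{\sqrt{6\varkappa\gamma^2+1}}{6\gamma}L^3|t|^3-4\sqrt2\cdot3^{-3/2}\big[\ln(1-3\cdot2^{-5/3}L^2t^2)+3\cdot2^{-5/3}L^2t^2\big]\Big\}-1\Big)e^{-t^2/2}.$$ The right-hand side of the general bound in (i) is monotonically increasing in $L>0$ and monotonically decreasing in $\gamma>0$, and, for $L^3=L_{E,n}^3$, also in $\varepsilon>0$; for $L^3=L_{R,n}^3(\varepsilon,\gamma)$ it does not depend on $\gamma$ for $\gamma\ge\gamma_*$. (ii) If $L^3=L_{E,n}^3(\varepsilon,\gamma)$, $L\le\overline L_0(\varepsilon)$ and $L|t|<\tau\le\overline\tau_0(\varepsilon)$, then $$r_n(t)\le A_E(\tau,\varepsilon,\gamma,L)\big(p_E(t,\varepsilon,\gamma)+B(\tau,\varepsilon)Lt^4\big)L^3e^{-t^2/2};$$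 in particular, for $\varepsilon=\infty$ (and $L|t|<\tau<2^{5/6}/\sqrt3$), $$r_n(t)\le\exp\Big\{\tfrac{\tau^3}{6\gamma}+\sqrt{\tfrac\varkappa6}\tau^3+\tau^4B(\tau)\Big\}\Big(\tfrac{\sqrt{6\varkappa\gamma^2+1}}{6\gamma}+B(\tau)L|t|\Big)L^3|t|^3e^{-t^2/2},$$ where $B(\tau)=B(\tau,\infty)=\sqrt3\cdot2^{-1/6}/(2^{5/3}-3\tau^2)$. This right-hand side (of the general bound in the Esseen case) is monotonically increasing in $L>0$ and monotonically decreasing in $\varepsilon>0$ and $\gamma>0$. If $L^3=L_{R,n}^3(\varepsilon,\gamma)$, $L\le\overline L_0(\varepsilon)$ and $L|t|<\tau\le\overline\tau_0(\varepsilon)$, then $$r_n(t)\le A_R(\tau,\varepsilon,\gamma,L)\big(p_R(t,\varepsilon,\gamma)+B(\tau,\varepsilon)Lt^4\big)L^3e^{-h(\tau,\varepsilon,L)t^2/2},$$ where $h(\tau,\varepsilon,L)=1-\varepsilon\tau^2L/6$, which is positive for all $\tau\in(0,\overline\tau_0(\varepsilon))$ if and only if $L\le6/(\varepsilon\overline\tau_0^2(\varepsilon))$; this right-hand side is monotonically increasing in $L>0$ and monotonically decreasing in $\gamma>0$.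
   Context: $X_1,\dots,X_n$ are independent real random variables with $\mathbb E X_k=0$, $\sigma_k^2=\mathbb E X_k^2<\infty$, normalized so that $\sum_k\sigma_k^2=1$; $f_k(t)=\mathbb E e^{itX_k}$, $\overline f_n(t)=\prod_kf_k(t)$. For $z\ge0$, $L_n(z)=\sum_k\mathbb E X_k^2\mathbf 1(|X_k|\ge z)$; for $z>0$, $M_n(z)=\sum_k\mathbb E X_k^3\mathbf 1(|X_k|<z)$. $L_{E,n}^3(\varepsilon,\gamma)=\sup_{0<z\le\varepsilon}\{\gamma|M_n(z)|+zL_n(z)\}$ ($\varepsilon\in(0,\infty]$), $L_{R,n}^3(\varepsilon,\gamma)=\gamma|M_n(\varepsilon)|+\sup_{0<z\le\varepsilon}zL_n(z)$ ($\varepsilon\in(0,\infty)$). Constants: $\varkappa=0.5315\ldots=\sup_{x>0}x^{-2}\sqrt{(\cos x-1+x^2/2)^2+(\sin x-x)^2}$, $\gamma_*=1/\sqrt{6\varkappa}$. Functions: $\alpha(\varepsilon)=\inf_{0<x<\min\{\varepsilon,1\}}(x-x^3)^{-2/3}$ (equal to $(\varepsilon-\varepsilon^3)^{-2/3}$ if $\varepsilon\le1/\sqrt3$, else $3\cdot2^{-2/3}$); $\overline\tau_0(\varepsilon)=\sqrt{2/\alpha(\varepsilon)}$; $\overline L_0(\varepsilon)=\varepsilon\overline\tau_0(\varepsilon)$; $\alpha_1(\varepsilon,L)=\min_{0<u\le\varepsilon/L}(\frac u2+\frac{\alpha(\varepsilon)}{4u})$, i.e. $\sqrt{\alpha(\varepsilon)/2}$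 if $L\le\overline L_0(\varepsilon)$ and $\frac\varepsilon{2L}+\frac{\alpha(\varepsilon)L}{4\varepsilon}$ otherwise. For $0<\tau<\overline\tau_0(\varepsilon)$: $B(\tau,\varepsilon,L)=-\frac{4\alpha_1(\varepsilon,L)}{\alpha^2(\varepsilon)\tau^4}[\ln(1-\frac12\alpha(\varepsilon)\tau^2)+\frac12\alpha(\varepsilon)\tau^2]$, $B(\tau,\varepsilon)=\frac{\sqrt{\alpha(\varepsilon)/2}}{2-\alpha(\varepsilon)\tau^2}$, $A(\tau,\varepsilon)=\exp\{\tau^4B(\tau,\varepsilon)\}$, $A_E(\tau,\varepsilon,\gamma,L)=A(\tau,\varepsilon)\exp\{\frac{\tau^3}{6\gamma}+\sqrt{\frac\varkappa3}\tau^3+\frac\varkappa\varepsilon L\tau^2\}$, $A_R(\tau,\varepsilon,\gamma,L)=A(\tau,\varepsilon)\exp\{\frac{\tau^3}{6\gamma}\mathbf 1(\gamma<\gamma_* )+\frac\varkappa\varepsilon L\tau^2\}$. Finally $p_E(t,\varepsilon,\gamma)=t^2\min_{0<z\le\varepsilon}[\frac{zt^2}{12}+\max\{\frac{|t|}{6\gamma},\frac\varkappa z-\frac{zt^2}{24}\}]$ and $p_R(t,\varepsilon,\gamma)=t^2\max\{\frac{|t|}{6\gamma},\frac\varkappa\varepsilon+\frac{\varepsilon t^2}{24},\frac{\varepsilon t^2}{12}\}$.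
   Formalization: In the general bounds of (ii), the condition L|t|<τ≤τ̄₀(ε) is taken as L|t|<τ<τ̄₀(ε), because at τ=τ̄₀(ε) the denominator 2−α(ε)τ² of B(τ,ε) vanishes and the bound is undefined. *)

theory Defs
  imports "HOL-Probability.Probability"
begin

definition varkappa :: real where
  "varkappa = (SUP x\<in>{0<..}. sqrt ((cos x - 1 + x^2/2)^2 + (sin x - x)^2) / x^2)"

definition gamma_star :: real where
  "gamma_star = 1 / sqrt (6 * varkappa)"

definition alpha :: "ereal \<Rightarrow> real" where
  "alpha e = Inf ((\<lambda>x. (x - x^3) powr (-2/3)) ` {x. 0 < x \<and> ereal x < min e 1})"

definition tau0 :: "ereal \<Rightarrow> real" where
  "tau0 e = sqrt (2 / alpha e)"

definition Lbar0 :: "ereal \<Rightarrow> ereal" where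
  "Lbar0 e = e * ereal (tau0 e)"

definition einv :: "ereal \<Rightarrow> real" where
  "einv e = (if e = \<infinity> then 0 else 1 / real_of_ereal e)"

definition alpha1 :: "ereal \<Rightarrow> real \<Rightarrow> real" where
  "alpha1 e L = Inf ((\<lambda>u. u/2 + alpha e / (4*u)) ` {u. 0 < u \<and> ereal u \<le> e / ereal L})"

definition B3 :: "real \<Rightarrow> ereal \<Rightarrow> real \<Rightarrow> real" where
  "B3 \<tau> e L = - (4 * alpha1 e L / ((alpha e)^2 * \<tau>^4)) *
       (ln (1 - alpha e * \<tau>^2 / 2) + alpha e * \<tau>^2 / 2)"

definition B2 :: "real \<Rightarrow> ereal \<Rightarrow> real" where
  "B2 \<tau> e = sqrt (alpha e / 2) / (2 - alpha e * \<tau>^2)"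

definition Afun :: "real \<Rightarrow> ereal \<Rightarrow> real" where
  "Afun \<tau> e = exp (\<tau>^4 * B2 \<tau> e)"

definition A_E :: "real \<Rightarrow> ereal \<Rightarrow> real \<Rightarrow> real \<Rightarrow> real" where
  "A_E \<tau> e \<gamma> L = Afun \<tau> e *
     exp (\<tau>^3 / (6*\<gamma>) + sqrt (varkappa/3) * \<tau>^3 + varkappa * einv e * L * \<tau>^2)"

definition A_R :: "real \<Rightarrow> real \<Rightarrow> real \<Rightarrow> real \<Rightarrow> real" where
  "A_R \<tau> e \<gamma> L = Afun \<tau> (ereal e) *
     exp (\<tau>^3 / (6*\<gamma>) * (if \<gamma> < gamma_star then 1 else 0) + varkappa / e * L * \<tau>^2)"

definition p_E :: "real \<Rightarrow> ereal \<Rightarrow> real \<Rightarrow> real" where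
  "p_E t e \<gamma> = t^2 * Inf ((\<lambda>z. z * t^2 / 12 + max (\<bar>t\<bar> / (6*\<gamma>)) (varkappa / z - z * t^2 / 24))
                           ` {z. 0 < z \<and> ereal z \<le> e})"

definition p_R :: "real \<Rightarrow> real \<Rightarrow> real \<Rightarrow> real" where
  "p_R t e \<gamma> = t^2 * max (\<bar>t\<bar> / (6*\<gamma>)) (max (varkappa / e + e * t^2 / 24) (e * t^2 / 12))"

definition hfun :: "real \<Rightarrow> real \<Rightarrow> real \<Rightarrow> real" where
  "hfun \<tau> e L = 1 - e * \<tau>^2 * L / 6"

definition rhs1 :: "real \<Rightarrow> ereal \<Rightarrow> real \<Rightarrow> real \<Rightarrow> real" where
  "rhs1 L e p t = (exp (L^3 * p + L^4 * t^4 * B3 (L * \<bar>t\<bar>) e L) - 1) * exp (- (t^2) / 2)"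

definition rhsE2 :: "real \<Rightarrow> ereal \<Rightarrow> real \<Rightarrow> real \<Rightarrow> real \<Rightarrow> real" where
  "rhsE2 \<tau> e \<gamma> L t = A_E \<tau> e \<gamma> L * (p_E t e \<gamma> + B2 \<tau> e * L * t^4) * L^3 * exp (- (t^2) / 2)"

definition rhsR2 :: "real \<Rightarrow> real \<Rightarrow> real \<Rightarrow> real \<Rightarrow> real \<Rightarrow> real" where
  "rhsR2 \<tau> e \<gamma> L t = A_R \<tau> e \<gamma> L * (p_R t e \<gamma> + B2 \<tau> (ereal e) * L * t^4) * L^3
       * exp (- hfun \<tau> e L * t^2 / 2)"

definition Ln :: "'a measure \<Rightarrow> (nat \<Rightarrow> 'a \<Rightarrow> real) \<Rightarrow> nat \<Rightarrow> real \<Rightarrow> real" where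
  "Ln M X n z = (\<Sum>k\<in>{1..n}. LINT \<omega>|M. (if \<bar>X k \<omega>\<bar> \<ge> z then (X k \<omega>)^2 else 0))"

definition Mn :: "'a measure \<Rightarrow> (nat \<Rightarrow> 'a \<Rightarrow> real) \<Rightarrow> nat \<Rightarrow> real \<Rightarrow> real" where
  "Mn M X n z = (\<Sum>k\<in>{1..n}. LINT \<omega>|M. (if \<bar>X k \<omega>\<bar> < z then (X k \<omega>)^3 else 0))"

definition LE3 :: "'a measure \<Rightarrow> (nat \<Rightarrow> 'a \<Rightarrow> real) \<Rightarrow> nat \<Rightarrow> ereal \<Rightarrow> real \<Rightarrow> ereal" where
  "LE3 M X n e \<gamma> = (SUP z\<in>{z. 0 < z \<and> ereal z \<le> e}. ereal (\<gamma> * \<bar>Mn M X n z\<bar> + z * Ln M X n z))"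

definition LR3 :: "'a measure \<Rightarrow> (nat \<Rightarrow> 'a \<Rightarrow> real) \<Rightarrow> nat \<Rightarrow> real \<Rightarrow> real \<Rightarrow> real" where
  "LR3 M X n e \<gamma> = \<gamma> * \<bar>Mn M X n e\<bar> + (SUP z\<in>{0<..e}. z * Ln M X n z)"

definition fbar :: "'a measure \<Rightarrow> (nat \<Rightarrow> 'a \<Rightarrow> real) \<Rightarrow> nat \<Rightarrow> real \<Rightarrow> complex" where
  "fbar M X n t = (\<Prod>k\<in>{1..n}. char (distr M borel (X k)) t)"

definition rn :: "'a measure \<Rightarrow> (nat \<Rightarrow> 'a \<Rightarrow> real) \<Rightarrow> nat \<Rightarrow> real \<Rightarrow> real" where
  "rn M X n t = cmod (fbar M X n t - complex_of_real (exp (- (t^2) / 2)))"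

end

theory Submission
  imports Defs
begin

text \<open>
  Write \<open>\<sigma>\<^sub>k\<^sup>2 = E X\<^sub>k\<^sup>2\<close>. The bound \<open>z L\<^sub>n(z) \<le> L\<^sup>3\<close> forces \<open>\<sigma>\<^sub>k\<^sup>2 \<le> \<alpha>(\<epsilon>) L\<^sup>2\<close>, so for
  \<open>L |t| < \<tau>\<^sub>0(\<epsilon>)\<close> every \<open>f\<^sub>k(t) - 1\<close> has modulus at most
  \<open>\<sigma>\<^sub>k\<^sup>2 t\<^sup>2 / 2 < 1\<close> and logarithms may be taken. Replacing \<open>ln f\<^sub>k\<close> by \<open>f\<^sub>k - 1\<close> costs a multiple of
  \<open>t\<^sup>4 (\<Sum>k. \<sigma>\<^sub>k\<^sup>4)\<close>, which is bounded by splitting one factor \<open>\<sigma>\<^sub>k\<^sup>2\<close> at level \<open>z\<close> and using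
  \<open>E Y \<cdot> E min(Y, c) \<le> E (Y min(Y, c))\<close> for \<open>Y = X\<^sub>k\<^sup>2\<close> together with the layer-cake formula
  \<open>(\<Sum>k. E X\<^sub>k\<^sup>2 min(X\<^sub>k\<^sup>2, z\<^sup>2)) = \<integral>\<^sub>0\<^sup>z 2 s L\<^sub>n(s) ds \<le> 2 z L\<^sup>3\<close>. The sum \<open>(\<Sum>k. f\<^sub>k - 1) + t\<^sup>2/2\<close> is
  estimated by the Taylor expansion of order three on \<open>|X\<^sub>k| < z\<close> and by \<open>\<kappa> t\<^sup>2 X\<^sub>k\<^sup>2\<close>
  on \<open>|X\<^sub>k| \<ge> z\<close>; the fourth moments on \<open>|X\<^sub>k| < z\<close> are again controlled by the layer-cake formula.
\<close>

subsection \<open>The constant kappa and logarithmic remainders\<close>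

text \<open>Identifies the numerator in the supremum defining \<open>varkappa\<close> as the modulus
  of the second-order Taylor remainder of \<open>iexp\<close>.\<close>

lemma iexp_taylor2:
  "cmod (iexp x - 1 - \<i> * x + x^2/2) = sqrt ((cos x - 1 + x^2/2)^2 + (sin x - x)^2)"
  by (simp add: cmod_def exp_Euler cos_of_real sin_of_real)

text \<open>A real \<open>SUP\<close> gives upper bounds only over a bounded family. The bound 1
  comes from the remainder estimate 2|x|^2/2!, which has the right order for all x, unlike the cubic
  one.\<close>

lemma varkappa_bdd_above:
  "bdd_above ((\<lambda>x. sqrt ((cos x - 1 + x^2/2)^2 + (sin x - x)^2) / x^2) ` {0<..})"
proof (rule bdd_aboveI2)
  fix x :: real assume "x \<in> {0<..}"
  then have x: "x > 0" by simp
  have "cmod (iexp x - (\<Sum>k\<le>2. (\<i> * x)^k / fact k)) \<le> 2 * \<bar>x\<bar>^2 / fact 2"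
    by (rule iexp_approx2)
  then have "cmod (iexp x - 1 - \<i> * x + x^2/2) \<le> x^2"
    by (simp add: numeral_2_eq_2 power_mult_distrib algebra_simps)
  then show "sqrt ((cos x - 1 + x^2/2)^2 + (sin x - x)^2) / x^2 \<le> 1"
    using x unfolding iexp_taylor2 by simp
qed

lemma varkappa_pos: "varkappa > 0"
proof -
  let ?g = "\<lambda>x::real. sqrt ((cos x - 1 + x^2/2)^2 + (sin x - x)^2) / x^2"
  \<comment> \<open>At \<open>2*pi\<close> the cosine is 1 and the sine 0, so both squares are
    explicit and positive.\<close>
  have "0 < ?g (2*pi)" by (simp add: add_pos_nonneg)
  also have "?g (2*pi) \<le> varkappa"
    unfolding varkappa_def by (rule cSUP_upper[OF _ varkappa_bdd_above]) simp
  finally show ?thesis .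
qed

lemma iexp_taylor2_le_varkappa:
  "cmod (iexp x - 1 - \<i> * x + x^2/2) \<le> varkappa * x^2"
proof -
  let ?g = "\<lambda>x::real. sqrt ((cos x - 1 + x^2/2)^2 + (sin x - x)^2)"
  have pos: "?g y \<le> varkappa * y^2" if "y > 0" for y
  proof -
    have "?g y / y^2 \<le> varkappa"
      unfolding varkappa_def by (rule cSUP_upper[OF _ varkappa_bdd_above]) (use that in simp)
    then show ?thesis using that by (simp add: field_simps)
  qed
  \<comment> \<open>The supremum runs over positive arguments only; evenness of the numerator covers
    the negative ones.\<close>
  have "?g (-x) = ?g x" by (simp add: power2_commute)
  then have "?g x \<le> varkappa * x^2"
    using pos[of x] pos[of "-x"] by (cases x "0::real" rule: linorder_cases) auto
  then show ?thesis unfolding iexp_taylor2 .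
qed

text \<open>The tail x^2/2 + x^3/3 + ... of the series of -ln(1-x). Its coefficients are
  nonnegative, so every estimate for it can be made term by term.\<close>

definition log_rem :: "real \<Rightarrow> real" where
  "log_rem x = - ln (1 - x) - x"

lemma log_rem_sums:
  assumes "0 \<le> x" "x < 1"
  shows "(\<lambda>n. x^(n+2) / real (n+2)) sums log_rem x"
proof -
  have "(\<lambda>n. - ((-(-x))^n) / real n) sums ln (1 + (-x))"
    by (rule ln_series') (use assms in auto)
  from sums_minus[OF this] have "(\<lambda>n. x^n / real n) sums (- ln (1 - x))"
    by simp
  \<comment> \<open>The term of index 0 is \<open>1/0 = 0\<close>, so dropping two terms removes
    just the linear term x.\<close>
  from sums_split_initial_segment[OF this, of 2] show ?thesis
    by (simp add: log_rem_def numeral_2_eq_2)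
qed

text \<open>The terms of the series of ln(1+z) - z have exactly the terms of \<open>log_rem\<close>
  at |z| as their moduli.\<close>

lemma norm_ln_minus_le_log_rem:
  assumes "cmod z < 1"
  shows "cmod (ln (1 + z) - z) \<le> log_rem (cmod z)"
proof -
  have "(\<lambda>n. - ((-z)^n) / of_nat n) sums ln (1 + z)"
    by (rule Ln_series'[OF assms])
  from sums_split_initial_segment[OF this, of 2]
  have "(\<lambda>n. - ((-z)^(n+2)) / of_nat (n+2)) sums (ln (1 + z) - z)"
    by (simp add: numeral_2_eq_2)
  moreover have "cmod (- ((-z)^(n+2)) / of_nat (n+2)) = cmod z^(n+2) / real (n+2)" for n
    by (simp only: norm_divide norm_minus_cancel norm_power norm_of_nat)
  ultimately show ?thesis
    using log_rem_sums[of "cmod z"] assms norm_sums_le by fastforce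
qed

lemma log_rem_nonneg: "0 \<le> x \<Longrightarrow> x < 1 \<Longrightarrow> 0 \<le> log_rem x"
  using sums_le[OF _ sums_zero log_rem_sums] by simp

lemma log_rem_0 [simp]: "log_rem 0 = 0"
  by (simp add: log_rem_def)

text \<open>Equivalently, \<open>log_rem x / x\<^sup>2\<close> is nondecreasing.\<close>

lemma log_rem_scale:
  assumes "0 \<le> x" "x \<le> y" "y < 1"
  shows "log_rem x * y^2 \<le> x^2 * log_rem y"
proof (rule sums_le)
  show "(\<lambda>n. x^(n+2) / real (n+2) * y^2) sums (log_rem x * y^2)"
    using assms by (intro sums_mult2 log_rem_sums) auto
  show "(\<lambda>n. x^2 * (y^(n+2) / real (n+2))) sums (x^2 * log_rem y)"
    using assms by (intro sums_mult log_rem_sums) auto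
  fix n
  have "x^n \<le> y^n" using assms by (intro power_mono) auto
  then have "x^n * (x^2 * y^2 / real (n+2)) \<le> y^n * (x^2 * y^2 / real (n+2))"
    by (intro mult_right_mono) auto
  then show "x^(n+2) / real (n+2) * y^2 \<le> x^2 * (y^(n+2) / real (n+2))"
    by (simp only: power_add times_divide_eq_right times_divide_eq_left mult_ac)
qed

lemma log_rem_mono:
  assumes "0 \<le> x" "x \<le> y" "y < 1"
  shows "log_rem x \<le> log_rem y"
proof (rule sums_le[OF _ log_rem_sums log_rem_sums])
  show "x^(n+2) / real (n+2) \<le> y^(n+2) / real (n+2)" for n
    using assms by (intro divide_right_mono power_mono) auto
qed (use assms in auto)

text \<open>Replacing every 1/(n+2) by 1/2 leaves a geometric series.\<close>

lemma log_rem_upper: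
  assumes "0 \<le> x" "x < 1"
  shows "log_rem x \<le> x^2 / (2 * (1 - x))"
proof (rule sums_le[OF _ log_rem_sums[OF assms]])
  have "(\<lambda>n. x^2 / 2 * x^n) sums (x^2 / 2 * (1 / (1 - x)))"
    using assms by (intro sums_mult geometric_sums) auto
  then show "(\<lambda>n. x^2 / 2 * x^n) sums (x^2 / (2 * (1 - x)))" by simp
  show "x^(n+2) / real (n+2) \<le> x^2 / 2 * x^n" for n
    using assms divide_left_mono[of 2 "real (n+2)" "x^(n+2)"] by (simp add: power_add power2_eq_square mult_ac)
qed

text \<open>Triangle inequality, term by term, in the exponential series without its constant
  term.\<close>

lemma norm_exp_minus_1_le:
  fixes w :: complex
  shows "cmod (exp w - 1) \<le> exp (cmod w) - 1"
proof -
  have "(\<lambda>n. w^n /\<^sub>R fact n) sums exp w" by (rule exp_converges)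
  from sums_split_initial_segment[OF this, of 1]
  have 1: "(\<lambda>n. w^(n+1) /\<^sub>R fact (n+1)) sums (exp w - 1)" by simp
  have "(\<lambda>n. cmod w^n /\<^sub>R fact n) sums exp (cmod w)" by (rule exp_converges)
  from sums_split_initial_segment[OF this, of 1]
  have 2: "(\<lambda>n. cmod w^(n+1) /\<^sub>R fact (n+1)) sums (exp (cmod w) - 1)" by simp
  show ?thesis
    by (rule norm_sums_le[OF 1 2]) (simp add: norm_power norm_mult divide_inverse mult_ac)
qed

section \<open>Taylor bounds for \<open>iexp\<close>\<close>

lemma iexp_taylor1: "cmod (iexp x - 1 - \<i> * x) \<le> x^2 / 2"
  using iexp_approx1[of x 1] by (simp add: algebra_simps power2_eq_square numeral_2_eq_2)

lemma iexp_taylor3: "cmod (iexp x - 1 - \<i> * x + x^2/2 + \<i> * x^3/6) \<le> x^4 / 24"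
proof -
  have sum: "(\<Sum>k\<le>3. (\<i> * x)^k / fact k) = 1 + \<i> * x - x^2/2 - \<i> * x^3/6"
    by (simp add: numeral_3_eq_3 power_mult_distrib fact_numeral power2_eq_square)
  have "iexp x - 1 - \<i> * x + x^2/2 + \<i> * x^3/6 = iexp x - (\<Sum>k\<le>3. (\<i> * x)^k / fact k)"
    unfolding sum by simp
  moreover have "\<bar>x\<bar> ^ Suc 3 / fact (Suc 3) = x^4 / 24"
    by (simp add: fact_numeral eval_nat_numeral)
  ultimately show ?thesis using iexp_approx1[of x 3] by (simp only:)
qed

subsection \<open>The functions alpha, alpha1 and p\<close>

text \<open>Supplies a point in the index sets of the infima \<open>alpha\<close>,
  \<open>alpha1\<close> and \<open>p_E\<close>, including infinite \<open>e\<close>.\<close>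

lemma ereal_pos_less_ex:
  fixes e :: ereal
  assumes "e > 0"
  shows "\<exists>x>0. ereal x < e"
  using ereal_dense2[OF assms] by auto

lemma alpha_set_nonempty:
  fixes e :: ereal
  assumes "e > 0"
  shows "{x. 0 < x \<and> ereal x < min e 1} \<noteq> {}"
  using ereal_pos_less_ex[of "min e 1"] assms by auto

text \<open>At a = 1/sqrt 3 the cubic x - x^3 takes its maximum 2a^3; the closed form is the
  smallest possible value of \<open>alpha\<close>.\<close>

lemma cubic_max_powr: "(2 * (1 / sqrt 3)^3) powr (-2/3) = 3 * 2 powr (-2/3)"
proof -
  define a :: real where "a = 1 / sqrt 3"
  have a: "a > 0" "a^2 = 1/3" by (simp_all add: a_def power_divide)
  have "(2 * a^3) powr (-2/3) = 2 powr (-2/3) * (a powr 3) powr (-2/3)"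
    using a by (simp add: powr_mult powr_numeral)
  also have "(a powr 3) powr (-2/3) = a powr (-2)" by (simp add: powr_powr)
  also have "\<dots> = 1 / a^2" using a(1) by (simp add: powr_minus_divide powr_numeral)
  also have "\<dots> = 3" unfolding a(2) by simp
  finally show ?thesis by (simp add: a_def)
qed

text \<open>With a = 1/sqrt 3 the gap 2a^3 - (x - x^3) has a double root at a and factors as (x-a)^2
  (x+2a); the negative power reverses the inequality.\<close>

lemma cubic_powr_lower:
  fixes x :: real
  assumes "0 < x" "x < 1"
  shows "3 * 2 powr (-2/3) \<le> (x - x^3) powr (-2/3)"
proof -
  define a :: real where "a = 1 / sqrt 3"
  have a: "a > 0" "a^2 = 1/3" by (simp_all add: a_def power_divide)
  have "0 \<le> (x - a)^2 * (x + 2*a)" using a assms by (intro mult_nonneg_nonneg) auto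
  also have "\<dots> = x^3 - 3 * a^2 * x + 2 * a^3"
    by (simp add: power2_eq_square power3_eq_cube algebra_simps)
  finally have le: "x - x^3 \<le> 2 * a^3" using a by simp
  have pos: "0 < x - x^3"
    using assms power_strict_decreasing[of 1 3 x] by simp
  have "(2 * a^3) powr (-2/3) = 3 * 2 powr (-2/3)"
    unfolding a_def by (rule cubic_max_powr)
  moreover have "(2 * a^3) powr (-2/3) \<le> (x - x^3) powr (-2/3)"
    using le pos by (intro powr_mono2') auto
  ultimately show ?thesis by simp
qed

text \<open>An upper bound on \<open>alpha\<close> needs one test point, a lower bound
  (\<open>alpha_ge\<close>) all of them; every later property of \<open>alpha\<close> follows from
  this pair.\<close>

lemma alpha_le:
  assumes "0 < x" "ereal x < min e 1"
  shows "alpha e \<le> (x - x^3) powr (-2/3)"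
  unfolding alpha_def using assms by (intro cINF_lower bdd_belowI2[where m = 0]) auto

lemma alpha_ge:
  assumes "e > 0" and "\<And>x. 0 < x \<Longrightarrow> ereal x < min e 1 \<Longrightarrow> c \<le> (x - x^3) powr (-2/3)"
  shows "c \<le> alpha e"
  unfolding alpha_def using assms alpha_set_nonempty by (intro cINF_greatest) auto

lemma alpha_lower: "e > 0 \<Longrightarrow> 3 * 2 powr (-2/3) \<le> alpha e"
  by (intro alpha_ge cubic_powr_lower) auto

lemma alpha_pos: "e > 0 \<Longrightarrow> 0 < alpha e"
  using alpha_lower[of e] by (simp add: less_le_trans[of 0 "3 * 2 powr (-2/3)"])

text \<open>A larger \<open>e\<close> enlarges the set over which the infimum is taken.\<close>

lemma alpha_antimono: "0 < e1 \<Longrightarrow> e1 \<le> e2 \<Longrightarrow> alpha e2 \<le> alpha e1"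
  by (intro alpha_ge alpha_le) (auto dest: less_le_trans)

lemma alpha_infinity: "alpha \<infinity> = 3 * 2 powr (-2/3)"
proof (rule antisym)
  define a :: real where "a = 1 / sqrt 3"
  have a: "a > 0" "a < 1" "a^2 = 1/3" by (simp_all add: a_def power_divide)
  have a3: "a^3 = a / 3" using a by (simp add: power3_eq_cube power2_eq_square)
  have "alpha \<infinity> \<le> (a - a^3) powr (-2/3)" using a by (intro alpha_le) auto
  also have "a - a^3 = 2 * a^3" using a3 by simp
  also have "(2 * a^3) powr (-2/3) = 3 * 2 powr (-2/3)"
    unfolding a_def by (rule cubic_max_powr)
  finally show "alpha \<infinity> \<le> 3 * 2 powr (-2/3)" .
qed (rule alpha_lower, simp)

lemma tau0_pos: "e > 0 \<Longrightarrow> 0 < tau0 e"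
  by (simp add: tau0_def alpha_pos)

text \<open>The form in which the restriction by \<open>tau0\<close> is used: it keeps the argument
  of the logarithm in \<open>B3\<close> and the denominator of \<open>B2\<close> positive.\<close>

lemma less_tau0D:
  assumes "e > 0" "0 \<le> \<tau>" "\<tau> < tau0 e"
  shows "alpha e * \<tau>^2 / 2 < 1"
proof -
  have "\<tau>^2 < (sqrt (2 / alpha e))^2"
    using assms unfolding tau0_def by (intro power_strict_mono) auto
  then show ?thesis using alpha_pos[OF assms(1)] by (simp add: field_simps)
qed

lemma tau0_mono: "0 < e1 \<Longrightarrow> e1 \<le> e2 \<Longrightarrow> tau0 e1 \<le> tau0 e2"
  unfolding tau0_def
  by (intro real_sqrt_le_mono divide_left_mono mult_pos_pos alpha_antimono alpha_pos) auto

section \<open>The constant \<open>alpha1\<close> and the scaled logarithmic term\<close>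

lemma ereal_le_divide_iff: "L > 0 \<Longrightarrow> ereal u \<le> e / ereal L \<longleftrightarrow> ereal (u * L) \<le> e"
  by (cases e) (auto simp: field_simps)

lemma alpha1_le:
  assumes "e > 0" "L > 0" "0 < u" "ereal (u * L) \<le> e"
  shows "alpha1 e L \<le> u/2 + alpha e / (4*u)"
  unfolding alpha1_def using assms alpha_pos[of e]
  by (intro cINF_lower bdd_belowI2[where m = 0]) (auto simp: ereal_le_divide_iff)

lemma alpha1_ge:
  assumes "e > 0" "L > 0" "\<And>u. 0 < u \<Longrightarrow> ereal (u * L) \<le> e \<Longrightarrow> c \<le> u/2 + alpha e / (4*u)"
  shows "c \<le> alpha1 e L"
  unfolding alpha1_def
proof (rule cINF_greatest)
  obtain x where x: "0 < x" "ereal x < e" using ereal_pos_less_ex[OF assms(1)] by auto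
  then have "x / L \<in> {u. 0 < u \<and> ereal u \<le> e / ereal L}"
    using assms by (auto simp: ereal_le_divide_iff)
  then show "{u. 0 < u \<and> ereal u \<le> e / ereal L} \<noteq> {}" by blast
qed (use assms in \<open>auto simp: ereal_le_divide_iff\<close>)

lemma alpha1_nonneg: "e > 0 \<Longrightarrow> L > 0 \<Longrightarrow> 0 \<le> alpha1 e L"
  using alpha_pos[of e] by (intro alpha1_ge) auto

lemma alpha1_mono:
  assumes "e > 0" "0 < L1" "L1 \<le> L2"
  shows "alpha1 e L1 \<le> alpha1 e L2"
proof (rule alpha1_ge)
  fix u assume u: "0 < u" "ereal (u * L2) \<le> e"
  have "ereal (u * L1) \<le> ereal (u * L2)" using u assms by simp
  also note u(2)
  finally show "alpha1 e L1 \<le> u/2 + alpha e / (4*u)"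
    using u assms by (intro alpha1_le) auto
qed (use assms in auto)

text \<open>Two effects work together: a larger \<open>e\<close> admits more values of u and lowers
  \<open>alpha\<close>.\<close>

lemma alpha1_antimono:
  assumes "0 < e1" "e1 \<le> e2" "0 < L"
  shows "alpha1 e2 L \<le> alpha1 e1 L"
proof (rule alpha1_ge)
  fix u assume u: "0 < u" "ereal (u * L) \<le> e1"
  have "alpha1 e2 L \<le> u/2 + alpha e2 / (4*u)"
    using u assms by (intro alpha1_le) auto
  also have "\<dots> \<le> u/2 + alpha e1 / (4*u)"
    using u assms alpha_antimono[of e1 e2] by (intro add_left_mono divide_right_mono) auto
  finally show "alpha1 e2 L \<le> u/2 + alpha e1 / (4*u)" .
qed (use assms in auto)

text \<open>The unconstrained minimiser of u/2 + alpha/(4u) is u = sqrt(alpha/2), with minimal value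
  u; the condition on \<open>Lbar0\<close> says precisely that it is admissible.\<close>

lemma alpha1_le_sqrt:
  assumes "e > 0" "L > 0" "ereal L \<le> Lbar0 e"
  shows "alpha1 e L \<le> sqrt (alpha e / 2)"
proof -
  define u where "u = sqrt (alpha e / 2)"
  have u: "u > 0" "u * u = alpha e / 2" using alpha_pos[OF assms(1)] by (simp_all add: u_def)
  have tau: "tau0 e = 1 / u" unfolding tau0_def u_def
    by (simp add: real_sqrt_divide)
  have "ereal (u * L) \<le> e"
    using assms u unfolding Lbar0_def tau by (cases e) (auto simp: field_simps)
  then have "alpha1 e L \<le> u/2 + alpha e / (4*u)"
    using u assms by (intro alpha1_le) auto
  also have "alpha e = 2 * (u * u)" using u by simp
  also have "u/2 + 2 * (u * u) / (4*u) = u" using u(1) by simp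
  finally show ?thesis by (simp only: u_def)
qed

text \<open>The factor (L|t|)^4 cancels the denominator of \<open>B3\<close>, which makes the
  expression valid at t = 0 too, where both sides vanish.\<close>

lemma B3_scaled:
  assumes "L > 0"
  shows "L^4 * t^4 * B3 (L * \<bar>t\<bar>) e L
    = 4 * alpha1 e L / (alpha e)^2 * log_rem (alpha e * (L * \<bar>t\<bar>)^2 / 2)"
proof (cases "t = 0")
  case False
  have "x^4 * (- (4 * a / (b * x^4)) * y) = 4 * a / b * (- y)" if "x \<noteq> 0" for a b x y :: real
    using that by simp
  from this[of "L * \<bar>t\<bar>"] have "(L * \<bar>t\<bar>)^4 * B3 (L * \<bar>t\<bar>) e L = 4 * alpha1 e L / (alpha e)^2
      * (- (ln (1 - alpha e * (L * \<bar>t\<bar>)^2 / 2) + alpha e * (L * \<bar>t\<bar>)^2 / 2))"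
    using assms False unfolding B3_def by (metis abs_eq_0 less_numeral_extra(3) mult_eq_0_iff)
  moreover have "L^4 * t^4 = (L * \<bar>t\<bar>)^4" by (simp add: power_mult_distrib)
  moreover have "log_rem x = - (ln (1 - x) + x)" for x by (simp add: log_rem_def)
  ultimately show ?thesis by (simp only:)
qed simp

section \<open>The function \<open>p_E\<close>\<close>

lemma p_E_le:
  assumes "\<gamma> > 0" "0 < z" "ereal z \<le> e"
  shows "p_E t e \<gamma> \<le> t^2 * (z * t^2 / 12 + max (\<bar>t\<bar> / (6*\<gamma>)) (varkappa / z - z * t^2 / 24))"
  unfolding p_E_def using assms
  by (intro mult_left_mono cINF_lower bdd_belowI2[where m = 0])
     (auto intro!: add_nonneg_nonneg simp: le_max_iff_disj)

lemma p_E_ge: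
  assumes "e > 0"
    and "\<And>z. 0 < z \<Longrightarrow> ereal z \<le> e \<Longrightarrow>
      c \<le> t^2 * (z * t^2 / 12 + max (\<bar>t\<bar> / (6*\<gamma>)) (varkappa / z - z * t^2 / 24))"
  shows "c \<le> p_E t e \<gamma>"
proof -
  obtain x where x: "0 < x" "ereal x < e" using ereal_pos_less_ex[OF assms(1)] by auto
  show ?thesis
  proof (cases "t = 0")
    \<comment> \<open>For t = 0 division by t^2 is impossible, but then \<open>p_E\<close> is 0 and
      any single test point gives c <= 0.\<close>
    case True
    then show ?thesis using assms(2)[of x] x by (simp add: p_E_def)
  next
    case False
    have "c / t^2 \<le> Inf ((\<lambda>z. z * t^2 / 12 + max (\<bar>t\<bar> / (6*\<gamma>)) (varkappa / z - z * t^2 / 24))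
                           ` {z. 0 < z \<and> ereal z \<le> e})"
      using x assms(2) False by (intro cINF_greatest) (auto simp: field_simps intro!: less_imp_le)
    then show ?thesis using False unfolding p_E_def by (simp add: pos_divide_le_eq mult.commute)
  qed
qed

lemma p_E_nonneg: "e > 0 \<Longrightarrow> \<gamma> > 0 \<Longrightarrow> 0 \<le> p_E t e \<gamma>"
  by (intro p_E_ge mult_nonneg_nonneg add_nonneg_nonneg) (auto simp: le_max_iff_disj)

lemma p_E_antimono_gamma:
  assumes "0 < \<gamma>1" "\<gamma>1 \<le> \<gamma>2" "e > 0"
  shows "p_E t e \<gamma>2 \<le> p_E t e \<gamma>1"
proof (rule p_E_ge)
  fix z assume z: "0 < z" "ereal z \<le> e"
  have "\<bar>t\<bar> / (6*\<gamma>2) \<le> \<bar>t\<bar> / (6*\<gamma>1)" using assms by (intro divide_left_mono) auto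
  then have "t^2 * (z * t^2 / 12 + max (\<bar>t\<bar> / (6*\<gamma>2)) (varkappa / z - z * t^2 / 24))
    \<le> t^2 * (z * t^2 / 12 + max (\<bar>t\<bar> / (6*\<gamma>1)) (varkappa / z - z * t^2 / 24))"
    by (intro mult_left_mono add_left_mono max.mono) auto
  with p_E_le[of \<gamma>2 z e t] z assms
  show "p_E t e \<gamma>2 \<le> t^2 * (z * t^2 / 12 + max (\<bar>t\<bar> / (6*\<gamma>1)) (varkappa / z - z * t^2 / 24))"
    by linarith
qed fact

lemma p_E_antimono_eps:
  "0 < e1 \<Longrightarrow> e1 \<le> e2 \<Longrightarrow> \<gamma> > 0 \<Longrightarrow> p_E t e2 \<gamma> \<le> p_E t e1 \<gamma>"
  by (intro p_E_ge p_E_le) auto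

text \<open>The test point z = 2(s-1)/(gamma |t|), with s the square root in the bound, makes both
  arguments of the maximum equal to |t|/(6 gamma).\<close>

lemma p_E_infinity_le:
  assumes "\<gamma> > 0"
  shows "p_E t \<infinity> \<gamma> \<le> sqrt (6 * varkappa * \<gamma>^2 + 1) / (6*\<gamma>) * \<bar>t\<bar>^3"
proof (cases "t = 0")
  case False
  define s where "s = sqrt (6 * varkappa * \<gamma>^2 + 1)"
  have s2: "s^2 = 6 * varkappa * \<gamma>^2 + 1" and s1: "s > 1"
    using varkappa_pos assms unfolding s_def by (simp_all add: add_nonneg_nonneg)
  define z where "z = 2 * (s - 1) / (\<gamma> * \<bar>t\<bar>)"
  have z: "z > 0" using s1 assms False by (simp add: z_def)
  have zt: "z * t^2 = 2 * (s - 1) * \<bar>t\<bar> / \<gamma>"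
    using assms False unfolding z_def by (simp add: field_simps power2_eq_square)
  \<comment> \<open>Since s^2 - 1 = 6 kappa gamma^2, the constant \<open>varkappa\<close> is
    expressed through s and the factor s - 1 cancels.\<close>
  have "varkappa / z = \<bar>t\<bar> * (s^2 - 1) / (12 * \<gamma> * (s - 1))"
    using assms False s1 unfolding s2 z_def by (simp add: field_simps power2_eq_square)
  also have "\<dots> = \<bar>t\<bar> * (s + 1) / (12 * \<gamma>)"
    using assms s1 by (simp add: field_simps power2_eq_square)
  finally have vz: "varkappa / z - z * t^2 / 24 = \<bar>t\<bar> / (6*\<gamma>)"
    unfolding zt using assms by (simp add: diff_divide_distrib add_divide_distrib algebra_simps)
  have "p_E t \<infinity> \<gamma> \<le> t^2 * (z * t^2 / 12 + max (\<bar>t\<bar> / (6*\<gamma>)) (varkappa / z - z * t^2 / 24))"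
    using assms z by (intro p_E_le) auto
  also have "\<dots> = t^2 * (z * t^2 / 12 + \<bar>t\<bar> / (6*\<gamma>))"
    unfolding vz by simp
  also have "\<dots> = t^2 * (s * \<bar>t\<bar> / (6*\<gamma>))"
    unfolding zt using assms by (simp add: field_simps)
  also have "\<dots> = s / (6*\<gamma>) * \<bar>t\<bar>^3"
    by (simp add: power3_eq_cube power2_eq_square abs_mult_self_eq mult_ac)
  finally show ?thesis unfolding s_def .
qed (simp add: p_E_def)

text \<open>Bound the maximum by |t|/(6 gamma) + kappa/z and minimise z t^2/12 + kappa/z over the
  admissible z. This produces the exponent of \<open>A_E\<close>.\<close>

lemma p_E_le_linear:
  assumes "\<gamma> > 0" "e > 0"
  shows "p_E t e \<gamma> \<le> \<bar>t\<bar>^3 / (6*\<gamma>) + sqrt (varkappa/3) * \<bar>t\<bar>^3 + varkappa * einv e * t^2"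
proof (cases "t = 0")
  case False
  define s where "s = sqrt (varkappa / 3)"
  have s: "s > 0" "varkappa = 3 * s^2" using varkappa_pos by (simp_all add: s_def)
  have ei: "einv e \<ge> 0" using assms by (cases e) (auto simp: einv_def)
  have t3: "\<bar>t\<bar>^3 = t^2 * \<bar>t\<bar>" by (simp add: power3_eq_cube power2_eq_square)
  have "\<exists>z>0. ereal z \<le> e \<and> z * t^2 / 12 + varkappa / z \<le> s * \<bar>t\<bar> + varkappa * einv e"
  \<comment> \<open>The unconstrained minimiser is z = 6s/|t|, with value s|t|.\<close>
  proof (cases "ereal (6 * s / \<bar>t\<bar>) \<le> e")
    case True
    have "6 * s / \<bar>t\<bar> * \<bar>t\<bar>^2 / 12 + 3 * s^2 / (6 * s / \<bar>t\<bar>) = s * \<bar>t\<bar>"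
      using s(1) False by (simp add: power2_eq_square del: abs_mult_self_eq)
    then have "6 * s / \<bar>t\<bar> * t^2 / 12 + varkappa / (6 * s / \<bar>t\<bar>) = s * \<bar>t\<bar>"
      using s(2) by simp
    then show ?thesis using True s False ei varkappa_pos
      by (intro exI[of _ "6 * s / \<bar>t\<bar>"]) auto
  next
    \<comment> \<open>If the minimiser exceeds \<open>e\<close>, take z = e: then z t^2/12 <=
      s|t|/2, and kappa/z is the term with \<open>einv\<close>.\<close>
    case F: False
    then obtain r where r: "e = ereal r" "r > 0" using assms by (cases e) auto
    with F False have "r * \<bar>t\<bar> \<le> 6 * s" by (auto simp: field_simps)
    then have "r * \<bar>t\<bar> * \<bar>t\<bar> \<le> 6 * s * \<bar>t\<bar>" by (intro mult_right_mono) auto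
    moreover have "r * \<bar>t\<bar> * \<bar>t\<bar> = r * t^2" by (simp add: power2_eq_square)
    moreover have "0 \<le> s * \<bar>t\<bar>" using s by simp
    ultimately have "r * t^2 / 12 \<le> s * \<bar>t\<bar>" by linarith
    then show ?thesis using r by (intro exI[of _ r]) (auto simp: einv_def)
  qed
  then obtain z where z: "z > 0" "ereal z \<le> e"
    "z * t^2 / 12 + varkappa / z \<le> s * \<bar>t\<bar> + varkappa * einv e" by blast
  have "0 \<le> \<bar>t\<bar> / (6*\<gamma>)" "0 \<le> varkappa / z" "0 \<le> z * t^2 / 24"
    using z varkappa_pos assms by auto
  then have "max (\<bar>t\<bar> / (6*\<gamma>)) (varkappa / z - z * t^2 / 24) \<le> \<bar>t\<bar> / (6*\<gamma>) + varkappa / z"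
    by linarith
  with z have "z * t^2 / 12 + max (\<bar>t\<bar> / (6*\<gamma>)) (varkappa / z - z * t^2 / 24)
     \<le> \<bar>t\<bar> / (6*\<gamma>) + s * \<bar>t\<bar> + varkappa * einv e"
    by linarith
  then have "t^2 * (z * t^2 / 12 + max (\<bar>t\<bar> / (6*\<gamma>)) (varkappa / z - z * t^2 / 24))
     \<le> t^2 * (\<bar>t\<bar> / (6*\<gamma>) + s * \<bar>t\<bar> + varkappa * einv e)"
    by (intro mult_left_mono) auto
  then have "p_E t e \<gamma> \<le> t^2 * (\<bar>t\<bar> / (6*\<gamma>) + s * \<bar>t\<bar> + varkappa * einv e)"
    using p_E_le[OF assms(1) z(1,2), of t] by linarith
  then show ?thesis unfolding s_def[symmetric] t3 by (simp add: algebra_simps)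
qed (simp add: p_E_def)

subsection \<open>Monotonicity and comparison of the right-hand sides\<close>

lemma rhs1_mono:
  assumes "L1^3 * p1 \<le> L2^3 * p2"
    and "L1^4 * t^4 * B3 (L1 * \<bar>t\<bar>) e1 L1 \<le> L2^4 * t^4 * B3 (L2 * \<bar>t\<bar>) e2 L2"
  shows "rhs1 L1 e1 p1 t \<le> rhs1 L2 e2 p2 t"
  unfolding rhs1_def using assms by (intro mult_right_mono diff_right_mono) auto

text \<open>Passes from (\<open>e1\<close>, \<open>L1\<close>) to (\<open>e2\<close>,
  \<open>L2\<close>) through (\<open>e1\<close>, \<open>L2\<close>), the argument \<open>y'\<close>.
  Raising L increases \<open>log_rem\<close>; the change of \<open>e\<close> uses that
  \<open>log_rem y / y^2\<close> is nondecreasing. The factor \<open>alpha1\<close> is monotone in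
  both variables.\<close>

lemma B3_term_mono:
  assumes L: "0 < L1" "L1 \<le> L2" and e: "0 < e2" "e2 \<le> e1" and t: "L2 * \<bar>t\<bar> < tau0 e2"
  shows "L1^4 * t^4 * B3 (L1 * \<bar>t\<bar>) e1 L1 \<le> L2^4 * t^4 * B3 (L2 * \<bar>t\<bar>) e2 L2"
proof (cases "t = 0")
  case False
  have e1: "e1 > 0" using e by order
  define y1 y' y2 where "y1 = alpha e1 * (L1 * \<bar>t\<bar>)^2 / 2"
    and "y' = alpha e1 * (L2 * \<bar>t\<bar>)^2 / 2" and "y2 = alpha e2 * (L2 * \<bar>t\<bar>)^2 / 2"
  have a: "0 < alpha e1" "0 < alpha e2" "alpha e1 \<le> alpha e2"
    using alpha_pos[OF e1] alpha_pos[OF e(1)] alpha_antimono[OF e] by auto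
  have y2: "y2 < 1" unfolding y2_def using L t by (intro less_tau0D e) auto
  have y'2: "y' \<le> y2" unfolding y'_def y2_def using a by (intro divide_right_mono mult_right_mono) auto
  have y1': "y1 \<le> y'" unfolding y'_def y1_def using a L
    by (intro divide_right_mono mult_left_mono power_mono mult_right_mono) auto
  have y1: "0 \<le> y1" using a by (simp add: y1_def)
  \<comment> \<open>At fixed L the argument y is proportional to \<open>alpha\<close>, so division
    by \<open>alpha^2\<close> is comparable with division by y^2.\<close>
  have "log_rem y' * y2^2 \<le> y'^2 * log_rem y2"
    using y1 y1' y'2 y2 by (intro log_rem_scale) auto
  moreover have "y2^2 = (alpha e2)^2 * ((L2 * \<bar>t\<bar>)^4 / 4)" "y'^2 = (alpha e1)^2 * ((L2 * \<bar>t\<bar>)^4 / 4)"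
    by (simp_all add: y2_def y'_def power_mult_distrib power_divide power_mult[symmetric])
  ultimately have "(log_rem y' * (alpha e2)^2) * ((L2 * \<bar>t\<bar>)^4 / 4) \<le> ((alpha e1)^2 * log_rem y2) * ((L2 * \<bar>t\<bar>)^4 / 4)"
    by (simp add: mult_ac)
  then have "log_rem y' * (alpha e2)^2 \<le> (alpha e1)^2 * log_rem y2"
    using False L by (subst (asm) mult_le_cancel_right_pos) auto
  then have "log_rem y' / (alpha e1)^2 \<le> log_rem y2 / (alpha e2)^2"
    using a by (simp add: field_simps)
  moreover have "log_rem y1 / (alpha e1)^2 \<le> log_rem y' / (alpha e1)^2"
    using y1 y1' y'2 y2 by (intro divide_right_mono log_rem_mono) auto
  ultimately have lr: "log_rem y1 / (alpha e1)^2 \<le> log_rem y2 / (alpha e2)^2" by linarith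
  have "alpha1 e1 L1 \<le> alpha1 e1 L2" using L e1 by (intro alpha1_mono)
  also have "\<dots> \<le> alpha1 e2 L2" using L e by (intro alpha1_antimono) auto
  finally have a1: "alpha1 e1 L1 \<le> alpha1 e2 L2" .
  have "4 * alpha1 e1 L1 * (log_rem y1 / (alpha e1)^2) \<le> 4 * alpha1 e2 L2 * (log_rem y2 / (alpha e2)^2)"
    using a1 lr y1 y1' y'2 y2 e L
    by (intro mult_mono) (auto intro!: divide_nonneg_nonneg log_rem_nonneg alpha1_nonneg)
  then show ?thesis
    using L unfolding y1_def y2_def by (simp add: B3_scaled)
qed simp

lemma rhs1_mono_L:
  assumes "0 < L1" "L1 \<le> L2" "e > 0" "L2 * \<bar>t\<bar> < tau0 e" "p \<ge> 0"
  shows "rhs1 L1 e p t \<le> rhs1 L2 e p t"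
  using assms by (intro rhs1_mono B3_term_mono mult_right_mono power_mono) auto

lemma rhs1_mono_p: "L > 0 \<Longrightarrow> p1 \<le> p2 \<Longrightarrow> rhs1 L e p1 t \<le> rhs1 L e p2 t"
  by (intro rhs1_mono mult_left_mono) auto

section \<open>The function \<open>p_R\<close> and the threshold \<open>gamma_star\<close>\<close>

lemma p_R_nonneg: "\<gamma> > 0 \<Longrightarrow> 0 \<le> p_R t e \<gamma>"
  unfolding p_R_def by (intro mult_nonneg_nonneg) (auto simp: le_max_iff_disj)

lemma p_R_antimono_gamma:
  assumes "0 < \<gamma>1" "\<gamma>1 \<le> \<gamma>2"
  shows "p_R t e \<gamma>2 \<le> p_R t e \<gamma>1"
proof -
  have "\<bar>t\<bar> / (6*\<gamma>2) \<le> \<bar>t\<bar> / (6*\<gamma>1)" using assms by (intro divide_left_mono) auto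
  then show ?thesis
    unfolding p_R_def by (intro mult_left_mono max.mono[OF _ order_refl]) auto
qed

lemma gamma_star_pos: "gamma_star > 0"
  using varkappa_pos by (simp add: gamma_star_def)

text \<open>By the arithmetic-geometric mean inequality the right-hand side is at least |t| sqrt(6
  kappa)/6 = |t|/(6 gamma_star); this is where the value of \<open>gamma_star\<close> comes
  from.\<close>

lemma gamma_star_le_max:
  assumes "gamma_star \<le> \<gamma>" "e > 0"
  shows "\<bar>t\<bar> / (6*\<gamma>) \<le> varkappa / e + e * t^2 / 24"
proof -
  define r where "r = sqrt (6 * varkappa)"
  have r: "r > 0" "varkappa = r^2 / 6" using varkappa_pos by (simp_all add: r_def)
  have "\<bar>t\<bar> / (6*\<gamma>) \<le> \<bar>t\<bar> / (6*gamma_star)"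
    using assms gamma_star_pos by (intro divide_left_mono) auto
  also have "\<dots> = r * \<bar>t\<bar> / 6" by (simp add: gamma_star_def r_def)
  also have "\<dots> \<le> r^2 / 6 / e + e * \<bar>t\<bar>^2 / 24"
  proof -
    have "0 \<le> (2 * r - e * \<bar>t\<bar>)^2 / (24 * e)" using assms by simp
    also have "\<dots> = r^2 / 6 / e + e * \<bar>t\<bar>^2 / 24 - r * \<bar>t\<bar> / 6"
      using assms by (simp add: field_simps power2_eq_square)
    finally show ?thesis by simp
  qed
  finally show ?thesis using r by simp
qed

lemma p_R_gamma_star:
  assumes "gamma_star \<le> \<gamma>" "e > 0"
  shows "p_R t e \<gamma> = t^2 * max (varkappa / e + e * t^2 / 24) (e * t^2 / 12)"
  using gamma_star_le_max[OF assms, of t] unfolding p_R_def by (simp add: max.absorb2 le_max_iff_disj)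

text \<open>Above \<open>gamma_star\<close> the first entry of the maximum is absorbed by the
  others, hence the indicator; below it the maximum is bounded by a sum.\<close>

lemma p_R_le_linear:
  assumes "\<gamma> > 0" "e > 0"
  shows "p_R t e \<gamma> \<le> \<bar>t\<bar>^3 / (6*\<gamma>) * (if \<gamma> < gamma_star then 1 else 0) + varkappa / e * t^2 + e * t^4 / 12"
proof -
  have nn: "0 \<le> varkappa / e" "0 \<le> e * t^2 / 24" "0 \<le> \<bar>t\<bar> / (6*\<gamma>)" using assms varkappa_pos by auto
  have "max (\<bar>t\<bar> / (6*\<gamma>)) (max (varkappa / e + e * t^2 / 24) (e * t^2 / 12))
    \<le> \<bar>t\<bar> / (6*\<gamma>) * (if \<gamma> < gamma_star then 1 else 0) + varkappa / e + e * t^2 / 12"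
    using nn gamma_star_le_max[of \<gamma> e t] assms by (cases "\<gamma> < gamma_star") auto
  then have "p_R t e \<gamma> \<le> t^2 * (\<bar>t\<bar> / (6*\<gamma>) * (if \<gamma> < gamma_star then 1 else 0) + varkappa / e + e * t^2 / 12)"
    unfolding p_R_def by (rule mult_left_mono) simp
  also have "\<dots> = t^2 * \<bar>t\<bar> / (6*\<gamma>) * (if \<gamma> < gamma_star then 1 else 0) + varkappa / e * t^2 + e * (t^2 * t^2) / 12"
    by (simp add: algebra_simps)
  also have "t^2 * \<bar>t\<bar> = \<bar>t\<bar>^3" by (simp add: power3_eq_cube power2_eq_square)
  also have "t^2 * t^2 = t^4" by (simp add: power_add[symmetric])
  finally show ?thesis .
qed

section \<open>From the exponential bound to the product bounds\<close>

lemma B2_nonneg: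
  assumes "e > 0" "0 \<le> \<tau>" "\<tau> < tau0 e"
  shows "0 \<le> B2 \<tau> e"
  using less_tau0D[OF assms] alpha_pos[OF assms(1)] unfolding B2_def by (intro divide_nonneg_nonneg) auto

lemma B2_antimono:
  assumes "0 < e1" "e1 \<le> e2" "0 \<le> \<tau>" "\<tau> < tau0 e1"
  shows "B2 \<tau> e2 \<le> B2 \<tau> e1"
proof -
  have a: "alpha e2 \<le> alpha e1" "alpha e2 * \<tau>^2 \<le> alpha e1 * \<tau>^2"
    using alpha_antimono[OF assms(1,2)] by (auto intro: mult_right_mono)
  then show ?thesis
    using less_tau0D[OF assms(1,3,4)] alpha_pos[OF assms(1)] unfolding B2_def
    by (intro frac_le) auto
qed

text \<open>Combines \<open>alpha1_le_sqrt\<close> with log_rem y <= y^2/(2(1-y)), then enlarges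
  L|t| to \<tau> in the denominator.\<close>

lemma B3_term_le_B2:
  assumes e: "e > 0" and L: "L > 0" "ereal L \<le> Lbar0 e" and t: "L * \<bar>t\<bar> < \<tau>" "\<tau> < tau0 e"
  shows "L^4 * t^4 * B3 (L * \<bar>t\<bar>) e L \<le> L^4 * t^4 * B2 \<tau> e"
proof -
  define a where "a = alpha e"
  define y where "y = a * (L * \<bar>t\<bar>)^2 / 2"
  have a: "a > 0" using alpha_pos[OF e] by (simp add: a_def)
  have tau: "0 < \<tau>" using t L by (smt (verit) mult_nonneg_nonneg abs_ge_zero)
  have "(L * \<bar>t\<bar>)^2 \<le> \<tau>^2" using t L by (intro power_mono) auto
  then have le: "a * (L * \<bar>t\<bar>)^2 \<le> a * \<tau>^2" using a by simp
  have t1: "a * \<tau>^2 / 2 < 1" unfolding a_def using less_tau0D[OF e _ t(2)] tau by simp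
  have y: "0 \<le> y" using a by (simp add: y_def)
  have y: "0 \<le> y" "y < 1" using y le t1 unfolding y_def by linarith+
  have "L^4 * t^4 * B3 (L * \<bar>t\<bar>) e L = 4 * alpha1 e L / a^2 * log_rem y"
    unfolding B3_scaled[OF L(1)] a_def y_def ..
  also have "\<dots> \<le> 4 * sqrt (a / 2) / a^2 * (y^2 / (2 * (1 - y)))"
    using alpha1_le_sqrt[OF e L] alpha1_nonneg[OF e L(1)] log_rem_upper[OF y] log_rem_nonneg[OF y] a
    by (intro mult_mono divide_right_mono) (auto simp: a_def)
  also have "\<dots> = 4 * sqrt (a / 2) / a^2 * (a^2 * (L^4 * t^4) / 4 / (2 * (1 - y)))"
    by (simp add: y_def power_mult_distrib power_divide power_mult[symmetric])
  also have "\<dots> = L^4 * t^4 * (sqrt (a / 2) / (2 - a * (L * \<bar>t\<bar>)^2))"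
  proof -
    have "4 * s / a^2 * (a^2 * c / 4 / d) = c * (s / d)" for s c d using a by simp
    moreover have "2 * (1 - y) = 2 - a * (L * \<bar>t\<bar>)^2" by (simp add: y_def)
    ultimately show ?thesis by (simp only:)
  qed
  also have "\<dots> \<le> L^4 * t^4 * (sqrt (a / 2) / (2 - a * \<tau>^2))"
    using a le t1 by (intro mult_left_mono frac_le) auto
  finally show ?thesis by (simp add: B2_def a_def)
qed

text \<open>Multiply 1 - w <= exp(-w) by exp w.\<close>

lemma exp_minus_1_le: "exp w - 1 \<le> w * exp w" for w :: real
proof -
  have "(1 - w) * exp w \<le> exp (-w) * exp w"
    using exp_ge_add_one_self[of "-w"] by (intro mult_right_mono) auto
  then show ?thesis by (simp add: algebra_simps exp_minus_inverse mult_exp_exp)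
qed

text \<open>With w the exponent, exp w - 1 <= w exp w. The factor w keeps its dependence on t;
  inside the exponential only the logarithmic term is enlarged to \<tau>, because the two choices of
  p are treated differently afterwards.\<close>

lemma rhs1_le_product:
  assumes e: "e > 0" and L: "L > 0" "ereal L \<le> Lbar0 e" and t: "L * \<bar>t\<bar> < \<tau>" "\<tau> < tau0 e"
    and p: "p \<ge> 0"
  shows "rhs1 L e p t \<le> exp (L^3 * p + \<tau>^4 * B2 \<tau> e) * (p + B2 \<tau> e * L * t^4) * L^3 * exp (- (t^2) / 2)"
proof -
  define w where "w = L^3 * p + L^4 * t^4 * B2 \<tau> e"
  have tau: "0 < \<tau>" using t L by (smt (verit) mult_nonneg_nonneg abs_ge_zero)
  have b: "0 \<le> B2 \<tau> e" using e tau t by (intro B2_nonneg) auto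
  have w: "w = (p + B2 \<tau> e * L * t^4) * L^3" by (simp add: w_def algebra_simps eval_nat_numeral)
  have w0: "0 \<le> w" using p L b by (simp add: w_def)
  have "(L * \<bar>t\<bar>)^4 \<le> \<tau>^4" using t L by (intro power_mono) auto
  then have "L^4 * t^4 * B2 \<tau> e \<le> \<tau>^4 * B2 \<tau> e"
    using b by (intro mult_right_mono) (auto simp: power_mult_distrib)
  then have w1: "w \<le> L^3 * p + \<tau>^4 * B2 \<tau> e" by (simp add: w_def)
  have "rhs1 L e p t \<le> (exp w - 1) * exp (- (t^2) / 2)"
    unfolding rhs1_def w_def using B3_term_le_B2[OF e L t]
    by (intro mult_right_mono diff_right_mono) auto
  also have "\<dots> \<le> (w * exp w) * exp (- (t^2) / 2)"
    by (intro mult_right_mono exp_minus_1_le) auto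
  also have "\<dots> \<le> (w * exp (L^3 * p + \<tau>^4 * B2 \<tau> e)) * exp (- (t^2) / 2)"
    using w0 w1 by (intro mult_right_mono mult_left_mono) auto
  finally show ?thesis unfolding w by (simp add: mult_ac)
qed

lemma einv_nonneg: "e > 0 \<Longrightarrow> 0 \<le> einv e"
  by (cases e) (auto simp: einv_def)

lemma einv_antimono: "0 < e1 \<Longrightarrow> e1 \<le> e2 \<Longrightarrow> einv e2 \<le> einv e1"
  by (cases e1; cases e2) (auto simp: einv_def frac_le)

lemma rhs1_le_rhsE2:
  assumes g: "\<gamma> > 0" and e: "e > 0" and L: "L > 0" "ereal L \<le> Lbar0 e"
    and t: "L * \<bar>t\<bar> < \<tau>" "\<tau> < tau0 e"
  shows "rhs1 L e (p_E t e \<gamma>) t \<le> rhsE2 \<tau> e \<gamma> L t"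
proof -
  have tau: "0 < \<tau>" using t L by (smt (verit) mult_nonneg_nonneg abs_ge_zero)
  have L3: "(L * \<bar>t\<bar>)^3 \<le> \<tau>^3" and L2: "(L * \<bar>t\<bar>)^2 \<le> \<tau>^2"
    using t L by (auto intro!: power_mono)
  have "L^3 * p_E t e \<gamma> \<le> L^3 * (\<bar>t\<bar>^3 / (6*\<gamma>) + sqrt (varkappa/3) * \<bar>t\<bar>^3 + varkappa * einv e * t^2)"
    using L by (intro mult_left_mono p_E_le_linear g e) auto
  also have "\<dots> = (L * \<bar>t\<bar>)^3 / (6*\<gamma>) + sqrt (varkappa/3) * (L * \<bar>t\<bar>)^3 + varkappa * einv e * L * (L * \<bar>t\<bar>)^2"
    by (simp add: power_mult_distrib algebra_simps power2_eq_square power3_eq_cube)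
  also have "\<dots> \<le> \<tau>^3 / (6*\<gamma>) + sqrt (varkappa/3) * \<tau>^3 + varkappa * einv e * L * \<tau>^2"
    using L2 L3 g L varkappa_pos einv_nonneg[OF e]
    by (intro add_mono divide_right_mono mult_left_mono) auto
  finally have "exp (L^3 * p_E t e \<gamma> + \<tau>^4 * B2 \<tau> e) \<le> A_E \<tau> e \<gamma> L"
    unfolding A_E_def Afun_def exp_add[symmetric] by simp
  then have "exp (L^3 * p_E t e \<gamma> + \<tau>^4 * B2 \<tau> e) * (p_E t e \<gamma> + B2 \<tau> e * L * t^4) * L^3 * exp (- (t^2) / 2)
    \<le> rhsE2 \<tau> e \<gamma> L t"
    unfolding rhsE2_def using p_E_nonneg[OF e g, of t] B2_nonneg[OF e _ t(2)] tau L
    by (intro mult_right_mono) auto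
  then show ?thesis
    using rhs1_le_product[OF e L t p_E_nonneg[OF e g, of t]] by linarith
qed

text \<open>The term e t^4/12 of \<open>p_R_le_linear\<close>, times L^3, is at most e L \<tau>^2
  t^2/12. It still carries t^2, so it is merged with the Gaussian exponent, which produces
  \<open>hfun\<close>.\<close>

lemma rhs1_le_rhsR2:
  assumes g: "\<gamma> > 0" and e: "e > 0" and L: "L > 0" "ereal L \<le> Lbar0 (ereal e)"
    and t: "L * \<bar>t\<bar> < \<tau>" "\<tau> < tau0 (ereal e)"
  shows "rhs1 L (ereal e) (p_R t e \<gamma>) t \<le> rhsR2 \<tau> e \<gamma> L t"
proof -
  have e': "ereal e > 0" using e by simp
  have tau: "0 < \<tau>" using t L by (smt (verit) mult_nonneg_nonneg abs_ge_zero)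
  have L3: "(L * \<bar>t\<bar>)^3 \<le> \<tau>^3" and L2: "(L * \<bar>t\<bar>)^2 \<le> \<tau>^2"
    using t L by (auto intro!: power_mono)
  let ?i = "if \<gamma> < gamma_star then 1 else 0 :: real"
  let ?b = "B2 \<tau> (ereal e)"
  have "L^3 * p_R t e \<gamma> \<le> L^3 * (\<bar>t\<bar>^3 / (6*\<gamma>) * ?i + varkappa / e * t^2 + e * t^4 / 12)"
    using L by (intro mult_left_mono p_R_le_linear g e) auto
  also have "\<dots> = (L * \<bar>t\<bar>)^3 / (6*\<gamma>) * ?i + varkappa / e * L * (L * \<bar>t\<bar>)^2 + e * L * t^2 / 12 * (L * \<bar>t\<bar>)^2"
    by (simp add: power_mult_distrib algebra_simps eval_nat_numeral)
  also have "\<dots> \<le> \<tau>^3 / (6*\<gamma>) * ?i + varkappa / e * L * \<tau>^2 + e * L * t^2 / 12 * \<tau>^2"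
    using L2 L3 g L e varkappa_pos
    by (intro add_mono divide_right_mono mult_left_mono mult_right_mono) auto
  finally have "L^3 * p_R t e \<gamma>
    \<le> \<tau>^3 / (6*\<gamma>) * ?i + varkappa / e * L * \<tau>^2 + e * L * t^2 / 12 * \<tau>^2" .
  moreover have "- hfun \<tau> e L * t^2 / 2 = - (t^2) / 2 + e * L * t^2 / 12 * \<tau>^2"
    by (simp add: hfun_def algebra_simps diff_divide_distrib)
  ultimately have "L^3 * p_R t e \<gamma> + \<tau>^4 * ?b + - (t^2) / 2
    \<le> \<tau>^4 * ?b + (\<tau>^3 / (6*\<gamma>) * ?i + varkappa / e * L * \<tau>^2) + - hfun \<tau> e L * t^2 / 2"
    by linarith
  then have "exp (L^3 * p_R t e \<gamma> + \<tau>^4 * ?b) * exp (- (t^2) / 2) \<le> A_R \<tau> e \<gamma> L * exp (- hfun \<tau> e L * t^2 / 2)"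
    unfolding A_R_def Afun_def exp_add[symmetric] by simp
  moreover have "0 \<le> (p_R t e \<gamma> + ?b * L * t^4) * L^3"
    using p_R_nonneg[OF g, of t e] B2_nonneg[OF e' _ t(2)] tau L by simp
  ultimately have "exp (L^3 * p_R t e \<gamma> + \<tau>^4 * ?b) * exp (- (t^2) / 2) * ((p_R t e \<gamma> + ?b * L * t^4) * L^3)
    \<le> A_R \<tau> e \<gamma> L * exp (- hfun \<tau> e L * t^2 / 2) * ((p_R t e \<gamma> + ?b * L * t^4) * L^3)"
    by (rule mult_right_mono)
  then have "exp (L^3 * p_R t e \<gamma> + \<tau>^4 * ?b) * (p_R t e \<gamma> + ?b * L * t^4) * L^3 * exp (- (t^2) / 2)
    \<le> rhsR2 \<tau> e \<gamma> L t"
    unfolding rhsR2_def by (simp only: mult_ac)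
  then show ?thesis
    using rhs1_le_product[OF e' L t p_R_nonneg[OF g, of t e]] by linarith
qed

text \<open>All factors are nonnegative and move in the same direction, so one joint comparison
  yields monotonicity in each of the three parameters.\<close>

lemma rhsE2_mono:
  assumes g: "0 < \<gamma>1" "\<gamma>1 \<le> \<gamma>2" and e: "0 < e1" "e1 \<le> e2" and L: "0 < L1" "L1 \<le> L2"
    and tau: "0 < \<tau>" "\<tau> < tau0 e1"
  shows "rhsE2 \<tau> e2 \<gamma>2 L1 t \<le> rhsE2 \<tau> e1 \<gamma>1 L2 t"
proof -
  have g2: "\<gamma>2 > 0" and e2: "e2 > 0" using g e by auto
  have tau2: "\<tau> < tau0 e2" using tau tau0_mono[OF e] by linarith
  have b: "B2 \<tau> e2 \<le> B2 \<tau> e1" "0 \<le> B2 \<tau> e2" "0 \<le> B2 \<tau> e1"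
    using e e2 tau tau2 by (auto intro: B2_antimono B2_nonneg)
  have p: "p_E t e2 \<gamma>2 \<le> p_E t e1 \<gamma>1" "0 \<le> p_E t e2 \<gamma>2" "0 \<le> p_E t e1 \<gamma>1"
    using p_E_antimono_gamma[OF g e2, of t] p_E_antimono_eps[OF e g(1), of t]
      p_E_nonneg[OF e2 g2, of t] p_E_nonneg[OF e(1) g(1), of t] by auto
  have "Afun \<tau> e2 \<le> Afun \<tau> e1"
    unfolding Afun_def using b tau by (auto intro!: mult_left_mono)
  moreover have "varkappa * einv e2 * L1 * \<tau>^2 \<le> varkappa * einv e1 * L2 * \<tau>^2"
    using einv_nonneg[OF e2] einv_nonneg[OF e(1)] einv_antimono[OF e] varkappa_pos L
    by (intro mult_mono mult_right_mono) auto
  moreover have "\<tau>^3 / (6*\<gamma>2) \<le> \<tau>^3 / (6*\<gamma>1)" using g tau by (intro divide_left_mono) auto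
  ultimately have A: "A_E \<tau> e2 \<gamma>2 L1 \<le> A_E \<tau> e1 \<gamma>1 L2"
    unfolding A_E_def by (intro mult_mono) (auto simp: Afun_def)
  have A0: "0 \<le> A_E \<tau> e1 \<gamma>1 L2" by (simp add: A_E_def Afun_def)
  have "B2 \<tau> e2 * L1 * t^4 \<le> B2 \<tau> e1 * L2 * t^4"
    using b L by (intro mult_mono) auto
  with p have "p_E t e2 \<gamma>2 + B2 \<tau> e2 * L1 * t^4 \<le> p_E t e1 \<gamma>1 + B2 \<tau> e1 * L2 * t^4"
    by linarith
  with A A0 p b L show ?thesis
    unfolding rhsE2_def by (intro mult_mono power_mono) auto
qed

lemma rhsR2_mono:
  assumes g: "0 < \<gamma>1" "\<gamma>1 \<le> \<gamma>2" and e: "0 < e" and L: "0 < L1" "L1 \<le> L2"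
    and tau: "0 < \<tau>" "\<tau> < tau0 (ereal e)"
  shows "rhsR2 \<tau> e \<gamma>2 L1 t \<le> rhsR2 \<tau> e \<gamma>1 L2 t"
proof -
  have g2: "\<gamma>2 > 0" using g by linarith
  have b: "0 \<le> B2 \<tau> (ereal e)" using e tau by (intro B2_nonneg) auto
  have p: "p_R t e \<gamma>2 \<le> p_R t e \<gamma>1" "0 \<le> p_R t e \<gamma>2" "0 \<le> p_R t e \<gamma>1"
    using p_R_antimono_gamma[OF g, of t e] p_R_nonneg[OF g2, of t e] p_R_nonneg[OF g(1), of t e] by auto
  have "varkappa / e * L1 * \<tau>^2 \<le> varkappa / e * L2 * \<tau>^2"
    using varkappa_pos L e by (intro mult_mono mult_right_mono) auto
  moreover have "\<tau>^3 / (6*\<gamma>2) \<le> \<tau>^3 / (6*\<gamma>1)" using g tau by (intro divide_left_mono) auto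
  then have "\<tau>^3 / (6*\<gamma>2) * (if \<gamma>2 < gamma_star then 1 else 0) \<le> \<tau>^3 / (6*\<gamma>1) * (if \<gamma>1 < gamma_star then 1 else 0)"
    using g tau by auto
  ultimately have A: "A_R \<tau> e \<gamma>2 L1 \<le> A_R \<tau> e \<gamma>1 L2"
    unfolding A_R_def by (intro mult_mono) (auto simp: Afun_def)
  have A0: "0 \<le> A_R \<tau> e \<gamma>1 L2" by (simp add: A_R_def Afun_def)
  have "B2 \<tau> (ereal e) * L1 * t^4 \<le> B2 \<tau> (ereal e) * L2 * t^4"
    using b L by (intro mult_mono) auto
  with p have 1: "p_R t e \<gamma>2 + B2 \<tau> (ereal e) * L1 * t^4 \<le> p_R t e \<gamma>1 + B2 \<tau> (ereal e) * L2 * t^4"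
    by linarith
  have "hfun \<tau> e L2 \<le> hfun \<tau> e L1"
    unfolding hfun_def using L e by (simp add: divide_right_mono mult_left_mono)
  then have "- hfun \<tau> e L1 * t^2 / 2 \<le> - hfun \<tau> e L2 * t^2 / 2"
    by (intro divide_right_mono mult_right_mono) auto
  with 1 show ?thesis
    unfolding rhsR2_def using A A0 p b L by (intro mult_mono power_mono) auto
qed

text \<open>Strict positivity on the open interval becomes a weak inequality at the endpoint, by
  letting \<tau> tend to \<open>tau0\<close> from the left.\<close>

lemma hfun_pos_iff:
  assumes e: "e > 0" and L: "L > 0"
  shows "(\<forall>\<tau>. 0 < \<tau> \<and> \<tau> < tau0 (ereal e) \<longrightarrow> hfun \<tau> e L > 0) \<longleftrightarrow> L \<le> 6 / (e * (tau0 (ereal e))^2)"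
proof -
  define T where "T = tau0 (ereal e)"
  have T: "T > 0" unfolding T_def using e by (intro tau0_pos) auto
  have iff: "L \<le> 6 / (e * T^2) \<longleftrightarrow> e * T^2 * L \<le> 6"
    using e T by (simp add: field_simps)
  show ?thesis unfolding T_def[symmetric] iff
  proof
    assume h: "\<forall>\<tau>. 0 < \<tau> \<and> \<tau> < T \<longrightarrow> hfun \<tau> e L > 0"
    show "e * T^2 * L \<le> 6"
    proof (rule tendsto_upperbound)
      show "((\<lambda>\<tau>. e * \<tau>^2 * L) \<longlongrightarrow> e * T^2 * L) (at_left T)"
        by (intro tendsto_intros)
      have "eventually (\<lambda>\<tau>. \<tau> \<in> {0<..<T}) (at_left T)"
        using T by (rule eventually_at_left_real)
      then show "eventually (\<lambda>\<tau>. e * \<tau>^2 * L \<le> 6) (at_left T)"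
      proof eventually_elim
        case (elim \<tau>)
        with h have "hfun \<tau> e L > 0" by auto
        then show ?case by (simp add: hfun_def)
      qed
    qed simp
  next
    assume h: "e * T^2 * L \<le> 6"
    show "\<forall>\<tau>. 0 < \<tau> \<and> \<tau> < T \<longrightarrow> hfun \<tau> e L > 0"
    proof (intro allI impI)
      fix \<tau> assume \<tau>: "0 < \<tau> \<and> \<tau> < T"
      then have "\<tau>^2 < T^2" by (intro power_strict_mono) auto
      then have "e * \<tau>^2 * L < e * T^2 * L" using e L by simp
      with h show "hfun \<tau> e L > 0" by (simp add: hfun_def)
    qed
  qed
qed

section \<open>Explicit constants for infinite \<open>e\<close>\<close>

lemma half_alpha_infinity: "alpha \<infinity> / 2 = 3 * 2 powr (-5/3)"
  unfolding alpha_infinity using powr_add[of "2::real" "-5/3" 1] by simp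

lemma sqrt_half_alpha_infinity: "sqrt (alpha \<infinity> / 2) = sqrt 3 * 2 powr (-5/6)"
  unfolding half_alpha_infinity by (simp add: real_sqrt_mult powr_half_sqrt[symmetric] powr_powr)

lemma tau0_infinity: "tau0 \<infinity> = 2 powr (5/6) / sqrt 3"
proof -
  have "tau0 \<infinity> = 1 / sqrt (alpha \<infinity> / 2)"
    unfolding tau0_def by (simp add: real_sqrt_divide)
  then show ?thesis
    unfolding sqrt_half_alpha_infinity by (simp add: powr_minus_divide)
qed

lemma B2_infinity: "B2 \<tau> \<infinity> = sqrt 3 * 2 powr (-1/6) / (2 powr (5/3) - 3 * \<tau>^2)"
proof -
  \<comment> \<open>Expanding the fraction by 2^(2/3) cancels the power of 2 in \<open>alpha\<close>
    and gives the stated denominator.\<close>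
  have "B2 \<tau> \<infinity> = (2 powr (2/3) * (sqrt 3 * 2 powr (-5/6))) / (2 powr (2/3) * (2 - alpha \<infinity> * \<tau>^2))"
    unfolding B2_def sqrt_half_alpha_infinity by simp
  also have "2 powr (2/3) * (sqrt 3 * 2 powr (-5/6)) = sqrt 3 * (2::real) powr (-1/6)"
    using powr_add[of "2::real" "2/3" "-5/6"] by simp
  also have "2 powr (2/3) * (2 - alpha \<infinity> * \<tau>^2) = 2 powr (5/3) - 3 * (2 powr (2/3) * 2 powr (-2/3)) * \<tau>^2"
    unfolding alpha_infinity using powr_add[of "2::real" "2/3" 1] by (simp add: algebra_simps)
  also have "2 powr (2/3) * 2 powr (-2/3) = (1::real)"
    by (simp add: powr_add[symmetric])
  finally show ?thesis by simp
qed

lemma Lbar0_infinity: "Lbar0 \<infinity> = \<infinity>"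
  using tau0_pos[of \<infinity>] by (simp add: Lbar0_def)

text \<open>This is the coefficient of \<open>log_rem\<close> in \<open>B3_scaled\<close> once
  \<open>alpha1\<close> is replaced by its bound sqrt(alpha/2).\<close>

lemma log_coeff_infinity: "4 * sqrt (alpha \<infinity> / 2) / (alpha \<infinity>)^2 = 4 * sqrt 2 * 3 powr (-3/2)"
proof -
  have 3: "3 powr (-3/2) = sqrt 3 / (9::real)"
  proof -
    have "3 powr (-3/2) = 3 powr (1/2) * (3::real) powr (-2)"
      by (simp add: powr_add[symmetric])
    then show ?thesis by (simp add: powr_half_sqrt powr_minus_divide)
  qed
  have "(alpha \<infinity>)^2 = 9 * (2 powr (-2/3))^2"
    by (simp add: alpha_infinity power_mult_distrib)
  also have "(2 powr (-2/3))^2 = (2::real) powr (-4/3)"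
    by (simp add: power2_eq_square powr_add[symmetric])
  finally have "4 * sqrt (alpha \<infinity> / 2) / (alpha \<infinity>)^2 = 4 * (sqrt 3 / 9) * (2 powr (-5/6) / 2 powr (-4/3))"
    unfolding sqrt_half_alpha_infinity by simp
  also have "2 powr (-5/6) / 2 powr (-4/3) = sqrt (2::real)"
    by (simp add: powr_diff[symmetric] powr_half_sqrt)
  finally show ?thesis unfolding 3 by simp
qed

lemma rhs1_infinity_le:
  assumes "\<gamma> > 0" "L > 0" "L * \<bar>t\<bar> < tau0 \<infinity>"
  shows "rhs1 L \<infinity> (p_E t \<infinity> \<gamma>) t \<le>
        (exp (sqrt (6 * varkappa * \<gamma>^2 + 1) / (6*\<gamma>) * L^3 * \<bar>t\<bar>^3
              - 4 * sqrt 2 * 3 powr (-3/2) *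
                (ln (1 - 3 * 2 powr (-5/3) * L^2 * t^2) + 3 * 2 powr (-5/3) * L^2 * t^2)) - 1)
        * exp (- (t^2) / 2)"
proof -
  let ?x = "3 * 2 powr (-5/3) * L^2 * t^2"
  have x: "alpha \<infinity> * (L * \<bar>t\<bar>)^2 / 2 = ?x"
    using half_alpha_infinity by (simp add: power_mult_distrib)
  have x1: "0 \<le> ?x" "?x < 1"
    using less_tau0D[of \<infinity> "L * \<bar>t\<bar>"] assms unfolding x by auto
  have "L^4 * t^4 * B3 (L * \<bar>t\<bar>) \<infinity> L = 4 * alpha1 \<infinity> L / (alpha \<infinity>)^2 * log_rem ?x"
    unfolding B3_scaled[OF assms(2)] x ..
  also have "\<dots> \<le> 4 * sqrt (alpha \<infinity> / 2) / (alpha \<infinity>)^2 * log_rem ?x"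
    using alpha1_le_sqrt[of \<infinity> L] assms log_rem_nonneg[OF x1]
    by (intro mult_right_mono divide_right_mono) (auto simp: Lbar0_infinity)
  also have "\<dots> = - 4 * sqrt 2 * 3 powr (-3/2) * (ln (1 - ?x) + ?x)"
    unfolding log_coeff_infinity log_rem_def by (simp add: algebra_simps)
  finally have 1: "L^4 * t^4 * B3 (L * \<bar>t\<bar>) \<infinity> L \<le> - 4 * sqrt 2 * 3 powr (-3/2) * (ln (1 - ?x) + ?x)" .
  have 2: "L^3 * p_E t \<infinity> \<gamma> \<le> L^3 * (sqrt (6 * varkappa * \<gamma>^2 + 1) / (6*\<gamma>) * \<bar>t\<bar>^3)"
    using assms by (intro mult_left_mono p_E_infinity_le) auto
  show ?thesis unfolding rhs1_def using 1 2
    by (intro mult_right_mono diff_right_mono) (auto simp: mult_ac)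
qed

text \<open>The constant sqrt(kappa/6), smaller than the one in \<open>A_E\<close>, comes from the
  estimate \<open>p_E_infinity_le\<close> and subadditivity of the square root: c <= 1/(6 gamma) +
  sqrt(kappa/6).\<close>

lemma rhs1_infinity_le_product:
  assumes g: "\<gamma> > 0" and L: "L > 0" and t: "L * \<bar>t\<bar> < \<tau>" "\<tau> < tau0 \<infinity>"
  shows "rhs1 L \<infinity> (p_E t \<infinity> \<gamma>) t \<le>
        exp (\<tau>^3 / (6*\<gamma>) + sqrt (varkappa / 6) * \<tau>^3
             + \<tau>^4 * (sqrt 3 * 2 powr (-1/6) / (2 powr (5/3) - 3 * \<tau>^2)))
        * (sqrt (6 * varkappa * \<gamma>^2 + 1) / (6*\<gamma>)
           + (sqrt 3 * 2 powr (-1/6) / (2 powr (5/3) - 3 * \<tau>^2)) * L * \<bar>t\<bar>)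
        * L^3 * \<bar>t\<bar>^3 * exp (- (t^2) / 2)"
proof -
  define c where "c = sqrt (6 * varkappa * \<gamma>^2 + 1) / (6*\<gamma>)"
  define b where "b = B2 \<tau> \<infinity>"
  have tau: "0 < \<tau>" using t L by (smt (verit) mult_nonneg_nonneg abs_ge_zero)
  have b0: "0 \<le> b" unfolding b_def using t tau by (intro B2_nonneg) auto
  have c0: "0 \<le> c" unfolding c_def using g varkappa_pos by (intro divide_nonneg_nonneg) auto
  have p: "p_E t \<infinity> \<gamma> \<le> c * \<bar>t\<bar>^3" unfolding c_def by (rule p_E_infinity_le[OF g])
  have p0: "0 \<le> p_E t \<infinity> \<gamma>" using g by (intro p_E_nonneg) auto
  have "sqrt (6 * varkappa * \<gamma>^2 + 1) \<le> sqrt (6 * varkappa * \<gamma>^2) + sqrt 1"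
    using varkappa_pos by (intro sqrt_add_le_add_sqrt) auto
  also have "6 * varkappa * \<gamma>^2 = (6 * \<gamma>)^2 * (varkappa / 6)" by (simp add: power2_eq_square)
  also have "sqrt \<dots> = 6 * \<gamma> * sqrt (varkappa / 6)"
    using g by (simp only: real_sqrt_mult real_sqrt_abs)
  finally have cl: "c \<le> 1 / (6*\<gamma>) + sqrt (varkappa / 6)"
    using g by (simp add: c_def field_simps)
  have "L^3 * p_E t \<infinity> \<gamma> \<le> L^3 * (c * \<bar>t\<bar>^3)" using p L by (intro mult_left_mono) auto
  also have "\<dots> = c * (L * \<bar>t\<bar>)^3" by (simp add: power_mult_distrib)
  also have "\<dots> \<le> (1 / (6*\<gamma>) + sqrt (varkappa / 6)) * \<tau>^3"
    using cl c0 t L by (intro mult_mono power_mono) auto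
  finally have "L^3 * p_E t \<infinity> \<gamma> + \<tau>^4 * b \<le> \<tau>^3 / (6*\<gamma>) + sqrt (varkappa / 6) * \<tau>^3 + \<tau>^4 * b"
    by (simp add: algebra_simps)
  then have ex: "exp (L^3 * p_E t \<infinity> \<gamma> + \<tau>^4 * b) \<le> exp (\<tau>^3 / (6*\<gamma>) + sqrt (varkappa / 6) * \<tau>^3 + \<tau>^4 * b)"
    (is "_ \<le> ?E") by simp
  have t4: "t^4 = \<bar>t\<bar>^3 * \<bar>t\<bar>" by (simp add: eval_nat_numeral)
  have "rhs1 L \<infinity> (p_E t \<infinity> \<gamma>) t \<le> exp (L^3 * p_E t \<infinity> \<gamma> + \<tau>^4 * b) * (p_E t \<infinity> \<gamma> + b * L * t^4) * L^3 * exp (- (t^2) / 2)"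
    unfolding b_def using L t p0 by (intro rhs1_le_product) (auto simp: Lbar0_infinity)
  also have "\<dots> \<le> ?E * (c * \<bar>t\<bar>^3 + b * L * t^4) * L^3 * exp (- (t^2) / 2)"
    using ex p p0 b0 c0 L by (intro mult_right_mono mult_mono) auto
  also have "\<dots> = ?E * (c + b * L * \<bar>t\<bar>) * L^3 * \<bar>t\<bar>^3 * exp (- (t^2) / 2)"
    unfolding t4 by (simp add: algebra_simps)
  finally show ?thesis unfolding c_def b_def B2_infinity .
qed

subsection \<open>Truncated moments\<close>

text \<open>The hypothesis controls only the sum over k, so expectation and sum are first moved
  inside the integral over s. Nonnegative integrals let Tonelli apply without integrability
  conditions.\<close>

lemma (in sigma_finite_measure) sum_integral_sq_min_le:
  fixes X :: "'b \<Rightarrow> 'a \<Rightarrow> real"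
  assumes fin: "finite I" and z: "z > 0"
    and meas [measurable]: "\<And>k. k \<in> I \<Longrightarrow> X k \<in> borel_measurable M"
    and int: "\<And>k. k \<in> I \<Longrightarrow> integrable M (\<lambda>\<omega>. (X k \<omega>)^2)"
    and bound: "\<And>s. 0 < s \<Longrightarrow> s \<le> z \<Longrightarrow>
      s * (\<Sum>k\<in>I. LINT \<omega>|M. (if \<bar>X k \<omega>\<bar> \<ge> s then (X k \<omega>)^2 else 0)) \<le> S"
  shows "(\<Sum>k\<in>I. LINT \<omega>|M. (X k \<omega>)^2 * min ((X k \<omega>)^2) (z^2)) \<le> 2 * z * S"
proof -
  let ?T = "\<lambda>k s \<omega>. if \<bar>X k \<omega>\<bar> \<ge> s then (X k \<omega>)^2 else 0"
  interpret pair_sigma_finite M lborel ..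
  have T_int: "integrable M (?T k s)" if "k \<in> I" for k s
    by (rule Bochner_Integration.integrable_bound[OF int[OF that]]) (use that in auto)
  have S0: "0 \<le> S"
    using bound[of z] z by (intro order_trans[OF _ bound[of z]] mult_nonneg_nonneg sum_nonneg) auto
  have layer: "(\<integral>\<^sup>+s. ennreal (2 * s * ?T k s \<omega>) * indicator {0<..z} s \<partial>lborel)
      = ennreal ((X k \<omega>)^2 * min ((X k \<omega>)^2) (z^2))" for k \<omega>
  proof -
    define m where "m = min \<bar>X k \<omega>\<bar> z"
    have m: "0 \<le> m" "m^2 = min ((X k \<omega>)^2) (z^2)"
      using z by (auto simp: m_def min_def power2_le_iff_abs_le abs_le_square_iff[symmetric])
    \<comment> \<open>For fixed \<omega> the truncation and the indicator together restrict s to at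
      most m; the added endpoint 0 contributes the value 0.\<close>
    have "(\<integral>\<^sup>+s. ennreal (2 * s * ?T k s \<omega>) * indicator {0<..z} s \<partial>lborel)
      = (\<integral>\<^sup>+s. ennreal (2 * s * (X k \<omega>)^2) * indicator {0..m} s \<partial>lborel)"
      by (intro nn_integral_cong) (auto simp: indicator_def m_def)
    also have "\<dots> = ennreal (m^2 * (X k \<omega>)^2 - 0^2 * (X k \<omega>)^2)"
      by (rule nn_integral_FTC_Icc) (auto intro!: derivative_eq_intros m)
    finally show ?thesis using m by (simp add: mult.commute)
  qed
  have "ennreal (\<Sum>k\<in>I. LINT \<omega>|M. (X k \<omega>)^2 * min ((X k \<omega>)^2) (z^2))
    = (\<Sum>k\<in>I. ennreal (LINT \<omega>|M. (X k \<omega>)^2 * min ((X k \<omega>)^2) (z^2)))"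
    by (intro sum_ennreal[symmetric]) auto
  also have "\<dots> = (\<Sum>k\<in>I. \<integral>\<^sup>+\<omega>. ennreal ((X k \<omega>)^2 * min ((X k \<omega>)^2) (z^2)) \<partial>M)"
  proof (intro sum.cong nn_integral_eq_integral[symmetric])
    fix k assume k: "k \<in> I"
    show "integrable M (\<lambda>\<omega>. (X k \<omega>)^2 * min ((X k \<omega>)^2) (z^2))"
      by (rule Bochner_Integration.integrable_bound[OF integrable_mult_left[OF int[OF k], of "z^2"]])
         (use k in \<open>auto simp: abs_mult intro!: mult_left_mono\<close>)
  qed auto
  also have "\<dots> = (\<Sum>k\<in>I. \<integral>\<^sup>+\<omega>. (\<integral>\<^sup>+s. ennreal (2 * s * ?T k s \<omega>) * indicator {0<..z} s \<partial>lborel) \<partial>M)"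
    by (simp only: layer)
  also have "\<dots> = (\<Sum>k\<in>I. \<integral>\<^sup>+s. (\<integral>\<^sup>+\<omega>. ennreal (2 * s * ?T k s \<omega>) * indicator {0<..z} s \<partial>M) \<partial>lborel)"
    by (intro sum.cong refl Fubini'[symmetric]) measurable
  also have "\<dots> = (\<integral>\<^sup>+s. (\<Sum>k\<in>I. \<integral>\<^sup>+\<omega>. ennreal (2 * s * ?T k s \<omega>) * indicator {0<..z} s \<partial>M) \<partial>lborel)"
    by (intro nn_integral_sum[symmetric]) measurable
  also have "\<dots> \<le> (\<integral>\<^sup>+s. ennreal (2 * S) * indicator {0<..z} s \<partial>lborel)"
  proof (intro nn_integral_mono)
    fix s :: real
    show "(\<Sum>k\<in>I. \<integral>\<^sup>+\<omega>. ennreal (2 * s * ?T k s \<omega>) * indicator {0<..z} s \<partial>M)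
        \<le> ennreal (2 * S) * indicator {0<..z} s"
    proof (cases "s \<in> {0<..z}")
      case True
      have "(\<Sum>k\<in>I. \<integral>\<^sup>+\<omega>. ennreal (2 * s * ?T k s \<omega>) * indicator {0<..z} s \<partial>M)
        = (\<Sum>k\<in>I. ennreal (LINT \<omega>|M. 2 * s * ?T k s \<omega>))"
      proof (intro sum.cong refl)
        fix k assume k: "k \<in> I"
        have "(\<integral>\<^sup>+\<omega>. ennreal (2 * s * ?T k s \<omega>) \<partial>M) = ennreal (LINT \<omega>|M. 2 * s * ?T k s \<omega>)"
          using True by (intro nn_integral_eq_integral integrable_mult_right T_int k) auto
        then show "(\<integral>\<^sup>+\<omega>. ennreal (2 * s * ?T k s \<omega>) * indicator {0<..z} s \<partial>M)
          = ennreal (LINT \<omega>|M. 2 * s * ?T k s \<omega>)"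
          using True by simp
      qed
      also have "\<dots> = ennreal (\<Sum>k\<in>I. LINT \<omega>|M. 2 * s * ?T k s \<omega>)"
        using True by (intro sum_ennreal integral_nonneg_AE) auto
      also have "(\<Sum>k\<in>I. LINT \<omega>|M. 2 * s * ?T k s \<omega>) = 2 * (s * (\<Sum>k\<in>I. LINT \<omega>|M. ?T k s \<omega>))"
        by (simp add: sum_distrib_left mult.assoc)
      also have "ennreal \<dots> \<le> ennreal (2 * S)"
        using True bound[of s] by (intro ennreal_leI mult_left_mono) auto
      finally show ?thesis using True by simp
    qed auto
  qed
  also have "\<dots> = ennreal (2 * S) * ennreal z"
    using z by (subst nn_integral_cmult_indicator) auto
  also have "\<dots> = ennreal (2 * z * S)"
    using S0 z by (simp add: ennreal_mult[symmetric] mult_ac)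
  finally show ?thesis using S0 z by (simp add: ennreal_le_iff)
qed

text \<open>Chebyshev's association inequality: Y and min(Y,c) increase together, so the centred
  product is pointwise nonnegative. Centring the second factor at min(\<mu>,c) costs nothing, as E(Y
  - \<mu>) = 0.\<close>

lemma (in prob_space) expectation_mult_min_ge:
  fixes Y :: "'a \<Rightarrow> real"
  assumes Y: "integrable M Y" and m: "integrable M (\<lambda>\<omega>. min (Y \<omega>) c)"
    and Ym: "integrable M (\<lambda>\<omega>. Y \<omega> * min (Y \<omega>) c)"
  shows "expectation Y * expectation (\<lambda>\<omega>. min (Y \<omega>) c) \<le> expectation (\<lambda>\<omega>. Y \<omega> * min (Y \<omega>) c)"
proof -
  define \<mu> where "\<mu> = expectation Y"
  have "0 \<le> expectation (\<lambda>\<omega>. (Y \<omega> - \<mu>) * (min (Y \<omega>) c - min \<mu> c))"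
  proof (rule integral_nonneg_AE, rule AE_I2)
    show "0 \<le> (Y \<omega> - \<mu>) * (min (Y \<omega>) c - min \<mu> c)" for \<omega>
      by (cases "Y \<omega> \<le> \<mu>")
         (auto intro: mult_nonpos_nonpos mult_nonneg_nonneg simp: min.coboundedI1)
  qed
  also have "(\<lambda>\<omega>. (Y \<omega> - \<mu>) * (min (Y \<omega>) c - min \<mu> c))
    = (\<lambda>\<omega>. Y \<omega> * min (Y \<omega>) c - \<mu> * min (Y \<omega>) c - (min \<mu> c * Y \<omega> - min \<mu> c * \<mu>))"
    by (auto simp: algebra_simps)
  also have "expectation \<dots> = expectation (\<lambda>\<omega>. Y \<omega> * min (Y \<omega>) c)
      - \<mu> * expectation (\<lambda>\<omega>. min (Y \<omega>) c) - (min \<mu> c * \<mu> - min \<mu> c * \<mu>)"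
    using assms by (simp add: prob_space \<mu>_def)
  finally show ?thesis unfolding \<mu>_def by simp
qed

subsection \<open>Characteristic functions\<close>

lemma norm_integral_le_integral:
  fixes f :: "'a \<Rightarrow> 'b::{banach,second_countable_topology}"
  assumes "integrable M f" "integrable M g" "\<And>x. norm (f x) \<le> g x"
  shows "norm (integral\<^sup>L M f) \<le> integral\<^sup>L M g"
  using assms by (intro order_trans[OF integral_norm_bound] integral_mono) auto

locale unit_variance_sum = prob_space M for M :: "'a measure" +
  fixes X :: "nat \<Rightarrow> 'a \<Rightarrow> real" and n :: nat
  assumes meas [measurable]: "\<And>k. k \<in> {1..n} \<Longrightarrow> X k \<in> borel_measurable M"
    and sq_int: "\<And>k. k \<in> {1..n} \<Longrightarrow> integrable M (\<lambda>\<omega>. (X k \<omega>)^2)"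
    and mean: "\<And>k. k \<in> {1..n} \<Longrightarrow> (LINT \<omega>|M. X k \<omega>) = 0"
    and var: "(\<Sum>k\<in>{1..n}. LINT \<omega>|M. (X k \<omega>)^2) = 1"
begin

definition sigma2 :: "nat \<Rightarrow> real" where
  "sigma2 k = expectation (\<lambda>\<omega>. (X k \<omega>)^2)"

definition tail2 :: "nat \<Rightarrow> real \<Rightarrow> real" where
  "tail2 k z = expectation (\<lambda>\<omega>. if \<bar>X k \<omega>\<bar> \<ge> z then (X k \<omega>)^2 else 0)"

definition char_dev :: "nat \<Rightarrow> real \<Rightarrow> complex" where
  "char_dev k t = char (distr M borel (X k)) t - 1"

lemma Ln_eq: "Ln M X n z = (\<Sum>k\<in>{1..n}. tail2 k z)"
  by (simp add: Ln_def tail2_def)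

lemma sigma2_sum: "(\<Sum>k\<in>{1..n}. sigma2 k) = 1"
  using var by (simp add: sigma2_def)

lemma sigma2_nonneg: "0 \<le> sigma2 k"
  by (simp add: sigma2_def)

lemma sigma2_le_1: "k \<in> {1..n} \<Longrightarrow> sigma2 k \<le> 1"
  using member_le_sum[of k "{1..n}" sigma2] sigma2_sum sigma2_nonneg by simp

lemma tail2_nonneg: "0 \<le> tail2 k z"
  by (auto simp: tail2_def intro!: integral_nonneg_AE)

lemma tail2_le_Ln: "k \<in> {1..n} \<Longrightarrow> tail2 k z \<le> Ln M X n z"
  unfolding Ln_eq by (intro member_le_sum tail2_nonneg) auto

lemma Ln_nonneg: "0 \<le> Ln M X n z"
  unfolding Ln_eq by (intro sum_nonneg tail2_nonneg)

lemma tail2_int: "k \<in> {1..n} \<Longrightarrow> integrable M (\<lambda>\<omega>. if \<bar>X k \<omega>\<bar> \<ge> z then (X k \<omega>)^2 else 0)"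
  by (rule Bochner_Integration.integrable_bound[OF sq_int]) auto

lemma tail2_le_sigma2: "k \<in> {1..n} \<Longrightarrow> tail2 k z \<le> sigma2 k"
  unfolding tail2_def sigma2_def by (intro integral_mono tail2_int sq_int) auto

lemma Ln_le_1: "Ln M X n z \<le> 1"
  unfolding Ln_eq sigma2_sum[symmetric] by (intro sum_mono tail2_le_sigma2)

lemma X_int: "k \<in> {1..n} \<Longrightarrow> integrable M (X k)"
  by (rule square_integrable_imp_integrable[OF meas sq_int])

lemma min_sq_int:
  assumes "k \<in> {1..n}"
  shows "integrable M (\<lambda>\<omega>. min ((X k \<omega>)^2) (z^2))"
  by (rule Bochner_Integration.integrable_bound[OF sq_int[OF assms]]) (use assms in auto)

lemma sq_min_sq_int:
  assumes "k \<in> {1..n}"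
  shows "integrable M (\<lambda>\<omega>. (X k \<omega>)^2 * min ((X k \<omega>)^2) (z^2))"
  by (rule Bochner_Integration.integrable_bound[OF integrable_mult_left[OF sq_int[OF assms], of "z^2"]])
     (use assms in \<open>auto simp: abs_mult intro!: mult_left_mono\<close>)

section \<open>Bounds for the variances of the summands\<close>

text \<open>The expectation of the minimum is kept, not bounded by z^2, so that
  \<open>expectation_mult_min_ge\<close> can be applied to it.\<close>

lemma sigma2_le_min_tail2:
  assumes k: "k \<in> {1..n}" and "z > 0"
  shows "sigma2 k \<le> expectation (\<lambda>\<omega>. min ((X k \<omega>)^2) (z^2)) + tail2 k z"
proof -
  have "sigma2 k \<le> expectation (\<lambda>\<omega>. min ((X k \<omega>)^2) (z^2) + (if \<bar>X k \<omega>\<bar> \<ge> z then (X k \<omega>)^2 else 0))"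
    unfolding sigma2_def
  proof (intro integral_mono sq_int[OF k] Bochner_Integration.integrable_add min_sq_int[OF k] tail2_int[OF k])
    fix \<omega>
    have "(X k \<omega>)^2 \<le> z^2" if "\<bar>X k \<omega>\<bar> < z"
      using that assms(2) by (simp add: abs_le_square_iff[symmetric])
    then show "(X k \<omega>)^2 \<le> min ((X k \<omega>)^2) (z^2) + (if \<bar>X k \<omega>\<bar> \<ge> z then (X k \<omega>)^2 else 0)"
      by auto
  qed
  also have "\<dots> = expectation (\<lambda>\<omega>. min ((X k \<omega>)^2) (z^2)) + tail2 k z"
    unfolding tail2_def by (intro Bochner_Integration.integral_add min_sq_int[OF k] tail2_int[OF k])
  finally show ?thesis .
qed

lemma sigma2_le_sq_tail2:
  assumes k: "k \<in> {1..n}" and "z > 0"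
  shows "sigma2 k \<le> z^2 + tail2 k z"
proof -
  have "expectation (\<lambda>\<omega>. min ((X k \<omega>)^2) (z^2)) \<le> expectation (\<lambda>\<omega>. z^2)"
    by (intro integral_mono min_sq_int[OF k]) auto
  then show ?thesis using sigma2_le_min_tail2[OF assms] by (simp add: prob_space)
qed

text \<open>Testing the bound on \<open>z L\<^sub>n(z)\<close> at \<open>z = x \<sigma>\<^sub>k\<close> gives \<open>\<sigma>\<^sub>k\<^sup>3 (x - x\<^sup>3) \<le> L\<^sup>3\<close>, which is the origin of \<^const>\<open>alpha\<close>.\<close>

lemma sigma2_le_alpha:
  assumes e: "e > 0" and L: "L > 0" and k: "k \<in> {1..n}"
    and tl: "\<And>z. 0 < z \<Longrightarrow> ereal z \<le> e \<Longrightarrow> z * Ln M X n z \<le> L^3"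
  shows "sigma2 k \<le> alpha e * L^2"
proof (cases "sigma2 k = 0")
  case True
  then show ?thesis using alpha_pos[OF e] by simp
next
  case False
  define \<sigma> where "\<sigma> = sqrt (sigma2 k)"
  have \<sigma>: "0 < \<sigma>" "\<sigma> \<le> 1" "sigma2 k = \<sigma>^2"
    using False sigma2_nonneg[of k] sigma2_le_1[OF k] by (auto simp: \<sigma>_def)
  have "(\<sigma> / L)^2 \<le> alpha e"
  proof (rule alpha_ge[OF e])
    fix x assume x: "0 < x" "ereal x < min e 1"
    then have x1: "x < 1" by simp
    have c: "0 < x - x^3"
      using x x1 power_strict_decreasing[of 1 3 x] by simp
    \<comment> \<open>The normalisation gives \<sigma> <= 1, so x < e makes x\<sigma> an admissible
      level.\<close>
    have "ereal (x * \<sigma>) \<le> ereal x" using x \<sigma> by (simp add: mult_left_le)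
    also have "\<dots> \<le> e" using x by (simp add: less_imp_le)
    finally have "x * \<sigma> * Ln M X n (x * \<sigma>) \<le> L^3" using x \<sigma> by (intro tl) auto
    moreover have "x * \<sigma> * (\<sigma>^2 - (x * \<sigma>)^2) \<le> x * \<sigma> * Ln M X n (x * \<sigma>)"
      using sigma2_le_sq_tail2[OF k, of "x * \<sigma>"] tail2_le_Ln[OF k, of "x * \<sigma>"] x \<sigma>
      by (intro mult_left_mono) auto
    moreover have "x * \<sigma> * (\<sigma>^2 - (x * \<sigma>)^2) = (x - x^3) * \<sigma>^3"
      by (simp add: power2_eq_square power3_eq_cube algebra_simps)
    ultimately have "x - x^3 \<le> (L / \<sigma>)^3"
      using \<sigma> by (simp add: power_divide field_simps)
    \<comment> \<open>The power -2/3 reverses the inequality and turns the cube of L/\<sigma> into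
      the square of \<sigma>/L.\<close>
    then have "((L / \<sigma>)^3) powr (-2/3) \<le> (x - x^3) powr (-2/3)"
      using c by (intro powr_mono2') auto
    moreover have "((L / \<sigma>)^3) powr (-2/3) = ((L / \<sigma>) powr 3) powr (-2/3)"
      using L \<sigma> by (simp add: powr_numeral)
    moreover have "\<dots> = (L / \<sigma>) powr (-2)" by (simp only: powr_powr) simp
    moreover have "\<dots> = (\<sigma> / L)^2"
      using L \<sigma> by (simp add: powr_minus_divide powr_numeral power_divide)
    ultimately show "(\<sigma> / L)^2 \<le> (x - x^3) powr (-2/3)" by simp
  qed
  then show ?thesis using L \<sigma> by (simp add: power_divide field_simps)
qed

lemma sum_sq_min_le:
  assumes "z > 0" "\<And>s. 0 < s \<Longrightarrow> s \<le> z \<Longrightarrow> s * Ln M X n s \<le> S"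
  shows "(\<Sum>k\<in>{1..n}. expectation (\<lambda>\<omega>. (X k \<omega>)^2 * min ((X k \<omega>)^2) (z^2))) \<le> 2 * z * S"
  using assms meas sq_int unfolding Ln_def by (intro sum_integral_sq_min_le) auto

text \<open>The splitting level is z = u L. The truncated part contributes 2 z L^3 = 2u L^4 and the
  tail part alpha L^2 (L^3/z) = (alpha/u) L^4.\<close>

lemma sum_sigma2_sq_le:
  assumes e: "e > 0" and L: "L > 0" and u: "u > 0" "ereal (u * L) \<le> e"
    and tl: "\<And>z. 0 < z \<Longrightarrow> ereal z \<le> e \<Longrightarrow> z * Ln M X n z \<le> L^3"
  shows "(\<Sum>k\<in>{1..n}. (sigma2 k)^2) \<le> (2 * u + alpha e / u) * L^4"
proof -
  define z where "z = u * L"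
  have z: "z > 0" "ereal z \<le> e" using u L by (auto simp: z_def)
  let ?m = "\<lambda>k. expectation (\<lambda>\<omega>. min ((X k \<omega>)^2) (z^2))"
  let ?q = "\<lambda>k. expectation (\<lambda>\<omega>. (X k \<omega>)^2 * min ((X k \<omega>)^2) (z^2))"
  have "(sigma2 k)^2 \<le> ?q k + alpha e * L^2 * tail2 k z" if k: "k \<in> {1..n}" for k
  proof -
    have "sigma2 k * sigma2 k \<le> sigma2 k * (?m k + tail2 k z)"
      using sigma2_le_min_tail2[OF k z(1)] sigma2_nonneg by (rule mult_left_mono)
    also have "\<dots> = sigma2 k * ?m k + sigma2 k * tail2 k z" by (simp add: algebra_simps)
    also have "sigma2 k * ?m k \<le> ?q k"
      unfolding sigma2_def by (intro expectation_mult_min_ge sq_int k min_sq_int sq_min_sq_int)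
    also have "sigma2 k * tail2 k z \<le> alpha e * L^2 * tail2 k z"
      using sigma2_le_alpha[OF e L k tl] tail2_nonneg by (intro mult_right_mono) auto
    finally show ?thesis by (simp add: power2_eq_square)
  qed
  then have "(\<Sum>k\<in>{1..n}. (sigma2 k)^2) \<le> (\<Sum>k\<in>{1..n}. ?q k + alpha e * L^2 * tail2 k z)"
    by (intro sum_mono) auto
  also have "\<dots> = (\<Sum>k\<in>{1..n}. ?q k) + alpha e * L^2 * Ln M X n z"
    by (simp add: sum.distrib sum_distrib_left Ln_eq)
  also have "(\<Sum>k\<in>{1..n}. ?q k) \<le> 2 * z * L^3"
  proof (rule sum_sq_min_le[OF z(1) tl])
    show "ereal s \<le> e" if "s \<le> z" for s
      using that z(2) by (meson ereal_less_eq(3) order_trans)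
  qed
  also have "Ln M X n z \<le> L^3 / z"
    using tl[OF z] z(1) by (simp add: field_simps)
  also have "2 * z * L^3 + alpha e * L^2 * (L^3 / z) = (2 * u + alpha e / u) * L^4"
    using u L by (simp add: z_def field_simps eval_nat_numeral)
  finally show ?thesis using alpha_pos[OF e] by (simp add: mult_left_mono)
qed

text \<open>After division by 4 L^4 the previous bound is u/2 + alpha/(4u), and optimising over u
  gives \<open>alpha1\<close>.\<close>

lemma sum_sigma2_sq_le_alpha1:
  assumes e: "e > 0" and L: "L > 0"
    and tl: "\<And>z. 0 < z \<Longrightarrow> ereal z \<le> e \<Longrightarrow> z * Ln M X n z \<le> L^3"
  shows "(\<Sum>k\<in>{1..n}. (sigma2 k)^2) \<le> 4 * alpha1 e L * L^4"
proof -
  have "(\<Sum>k\<in>{1..n}. (sigma2 k)^2) / (4 * L^4) \<le> alpha1 e L"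
  proof (rule alpha1_ge[OF e L])
    fix u assume u: "0 < u" "ereal (u * L) \<le> e"
    have "(\<Sum>k\<in>{1..n}. (sigma2 k)^2) / (4 * L^4) \<le> (2 * u + alpha e / u) * L^4 / (4 * L^4)"
      using L by (intro divide_right_mono sum_sigma2_sq_le[OF e L u tl]) auto
    also have "\<dots> = u/2 + alpha e / (4*u)" using L u by (simp add: field_simps)
    finally show "(\<Sum>k\<in>{1..n}. (sigma2 k)^2) / (4 * L^4) \<le> u/2 + alpha e / (4*u)" .
  qed
  then show ?thesis using L by (simp add: field_simps)
qed

section \<open>Expansion of the characteristic functions\<close>

lemma iexp_int: "k \<in> {1..n} \<Longrightarrow> integrable M (\<lambda>\<omega>. iexp (t * X k \<omega>))"
  by (rule integrable_iexp) auto

text \<open>The mean is zero, so the linear Taylor term can be subtracted under the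
  expectation.\<close>

lemma char_dev_eq1:
  assumes k: "k \<in> {1..n}"
  shows "integrable M (\<lambda>\<omega>. iexp (t * X k \<omega>) - 1 - \<i> * complex_of_real (t * X k \<omega>))"
    and "char_dev k t = expectation (\<lambda>\<omega>. iexp (t * X k \<omega>) - 1 - \<i> * complex_of_real (t * X k \<omega>))"
proof -
  have 1: "integrable M (\<lambda>\<omega>. \<i> * complex_of_real (t * X k \<omega>))"
    using X_int[OF k] by (intro integrable_mult_right integrable_of_real) auto
  then show "integrable M (\<lambda>\<omega>. iexp (t * X k \<omega>) - 1 - \<i> * complex_of_real (t * X k \<omega>))"
    using iexp_int[OF k] by (intro Bochner_Integration.integrable_diff) auto
  have "expectation (\<lambda>\<omega>. \<i> * complex_of_real (t * X k \<omega>)) = \<i> * expectation (\<lambda>\<omega>. complex_of_real (t * X k \<omega>))"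
    by (rule integral_mult_right_zero)
  also have "expectation (\<lambda>\<omega>. complex_of_real (t * X k \<omega>)) = complex_of_real (expectation (\<lambda>\<omega>. t * X k \<omega>))"
    by (rule integral_complex_of_real)
  also have "\<i> * \<dots> = 0" using mean[OF k] by simp
  finally have "expectation (\<lambda>\<omega>. iexp (t * X k \<omega>) - 1 - \<i> * complex_of_real (t * X k \<omega>))
    = expectation (\<lambda>\<omega>. iexp (t * X k \<omega>)) - 1"
    using 1 iexp_int[OF k] by (simp add: prob_space)
  moreover have "char (distr M borel (X k)) t = expectation (\<lambda>\<omega>. iexp (t * X k \<omega>))"
    unfolding char_def using k by (subst integral_distr) auto
  ultimately show "char_dev k t = expectation (\<lambda>\<omega>. iexp (t * X k \<omega>) - 1 - \<i> * complex_of_real (t * X k \<omega>))"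
    by (simp add: char_dev_def)
qed

lemma norm_char_dev_le:
  assumes k: "k \<in> {1..n}"
  shows "cmod (char_dev k t) \<le> t^2 * sigma2 k / 2"
proof -
  have "cmod (char_dev k t) \<le> expectation (\<lambda>\<omega>. (t * X k \<omega>)^2 / 2)"
    unfolding char_dev_eq1(2)[OF k]
  proof (rule norm_integral_le_integral)
    show "integrable M (\<lambda>\<omega>. iexp (t * X k \<omega>) - 1 - \<i> * complex_of_real (t * X k \<omega>))"
      by (rule char_dev_eq1(1)[OF k])
    show "integrable M (\<lambda>\<omega>. (t * X k \<omega>)^2 / 2)"
      using sq_int[OF k] by (simp add: power_mult_distrib)
  qed (rule iexp_taylor1)
  then show ?thesis by (simp add: power_mult_distrib sigma2_def)
qed

text \<open>The third-order Taylor bound is used for |X| < z, and the second-order bound with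
  \<open>varkappa\<close> for |X| >= z. The difference in the first term is the fourth moment on |X|
  < z, written through the quantity that the layer-cake formula controls.\<close>

lemma char_dev_cubic:
  assumes k: "k \<in> {1..n}" and z: "z > 0"
  shows "cmod (char_dev k t + t^2 * sigma2 k / 2
      + \<i> * complex_of_real (t^3 / 6 * expectation (\<lambda>\<omega>. if \<bar>X k \<omega>\<bar> < z then (X k \<omega>)^3 else 0)))
    \<le> t^4 / 24 * (expectation (\<lambda>\<omega>. (X k \<omega>)^2 * min ((X k \<omega>)^2) (z^2)) - z^2 * tail2 k z)
      + varkappa * t^2 * tail2 k z"
proof -
  let ?T = "\<lambda>\<omega>. if \<bar>X k \<omega>\<bar> \<ge> z then (X k \<omega>)^2 else 0"
  let ?C = "\<lambda>\<omega>. if \<bar>X k \<omega>\<bar> < z then (X k \<omega>)^3 else 0"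
  let ?Q = "\<lambda>\<omega>. (X k \<omega>)^2 * min ((X k \<omega>)^2) (z^2)"
  let ?F = "\<lambda>\<omega>. iexp (t * X k \<omega>) - 1 - \<i> * complex_of_real (t * X k \<omega>)"
  let ?P = "\<lambda>\<omega>. complex_of_real (t^2 / 2 * (X k \<omega>)^2)"
  let ?D = "\<lambda>\<omega>. \<i> * complex_of_real (t^3 / 6 * ?C \<omega>)"
  have C: "integrable M ?C"
  proof (rule integrable_const_bound[where B = "z^3"])
    have "\<bar>X k \<omega>\<bar>^3 \<le> z^3" if "\<bar>X k \<omega>\<bar> < z" for \<omega>
      using that by (intro power_mono) auto
    then show "AE \<omega> in M. norm (?C \<omega>) \<le> z^3" using z by (auto simp: power_abs)
  qed (use k in measurable)
  have P: "integrable M ?P"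
    using sq_int[OF k] by (intro integrable_of_real integrable_mult_right) auto
  have D: "integrable M ?D"
    using C by (intro integrable_mult_right integrable_of_real) auto
  have FP: "integrable M (\<lambda>\<omega>. ?F \<omega> + ?P \<omega>)"
    by (intro Bochner_Integration.integrable_add char_dev_eq1(1)[OF k] P)
  have "expectation (\<lambda>\<omega>. ?F \<omega> + ?P \<omega> + ?D \<omega>) = char_dev k t + expectation ?P + expectation ?D"
    by (simp only: Bochner_Integration.integral_add[OF FP D]
        Bochner_Integration.integral_add[OF char_dev_eq1(1)[OF k] P] char_dev_eq1(2)[OF k])
  also have "expectation ?P = complex_of_real (expectation (\<lambda>\<omega>. t^2 / 2 * (X k \<omega>)^2))"
    by (rule integral_complex_of_real)
  also have "expectation (\<lambda>\<omega>. t^2 / 2 * (X k \<omega>)^2) = t^2 * sigma2 k / 2"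
    by (simp add: sigma2_def)
  also have "expectation ?D = \<i> * complex_of_real (t^3 / 6 * expectation ?C)"
    by (simp only: integral_mult_right_zero integral_complex_of_real)
  finally have eq: "expectation (\<lambda>\<omega>. ?F \<omega> + ?P \<omega> + ?D \<omega>)
    = char_dev k t + t^2 * sigma2 k / 2 + \<i> * complex_of_real (t^3 / 6 * expectation ?C)" .
  have G: "integrable M (\<lambda>\<omega>. t^4 / 24 * (?Q \<omega> - z^2 * ?T \<omega>) + varkappa * t^2 * ?T \<omega>)"
    by (intro Bochner_Integration.integrable_add Bochner_Integration.integrable_diff
        integrable_mult_right sq_min_sq_int[OF k] tail2_int[OF k])
  have "cmod (expectation (\<lambda>\<omega>. ?F \<omega> + ?P \<omega> + ?D \<omega>))
    \<le> expectation (\<lambda>\<omega>. t^4 / 24 * (?Q \<omega> - z^2 * ?T \<omega>) + varkappa * t^2 * ?T \<omega>)"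
  proof (rule norm_integral_le_integral[OF Bochner_Integration.integrable_add[OF FP D] G])
    fix \<omega>
    define x where "x = X k \<omega>"
    define y where "y = t * x"
    have P: "?P \<omega> = y^2/2" by (simp add: x_def y_def power_mult_distrib)
    have F: "?F \<omega> = iexp y - 1 - \<i> * y" by (simp add: x_def y_def)
    show "cmod (?F \<omega> + ?P \<omega> + ?D \<omega>) \<le> t^4 / 24 * (?Q \<omega> - z^2 * ?T \<omega>) + varkappa * t^2 * ?T \<omega>"
    proof (cases "\<bar>x\<bar> < z")
      case True
      then have "x^2 \<le> z^2" using z by (simp add: abs_le_square_iff[symmetric])
      then have "t^4 / 24 * (?Q \<omega> - z^2 * ?T \<omega>) + varkappa * t^2 * ?T \<omega> = y^4 / 24"
        using True by (simp add: x_def y_def power_mult_distrib eval_nat_numeral)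
      moreover have "?D \<omega> = \<i> * y^3/6"
        using True by (simp add: x_def y_def power_mult_distrib)
      ultimately show ?thesis unfolding F P using iexp_taylor3[of y] by (simp only:)
    next
      case False
      then have "z^2 \<le> x^2" using z by (simp add: abs_le_square_iff[symmetric])
      then have "t^4 / 24 * (?Q \<omega> - z^2 * ?T \<omega>) + varkappa * t^2 * ?T \<omega> = varkappa * y^2"
        using False by (simp add: x_def y_def power_mult_distrib)
      moreover have "?D \<omega> = 0"
        using False by (simp add: x_def)
      ultimately show ?thesis unfolding F P using iexp_taylor2_le_varkappa[of y]
        by (simp only: add_0_right)
    qed
  qed
  also have "\<dots> = t^4 / 24 * (expectation ?Q - z^2 * tail2 k z) + varkappa * t^2 * tail2 k z"
    using sq_min_sq_int[OF k] tail2_int[OF k] by (simp add: tail2_def)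
  finally show ?thesis unfolding eq .
qed

text \<open>The quadratic terms add up to t^2/2 by the normalisation, and the cubic ones to a
  multiple of \<open>Mn\<close>, split off by the triangle inequality.\<close>

lemma sum_char_dev_le:
  assumes z: "z > 0" and tl: "\<And>s. 0 < s \<Longrightarrow> s \<le> z \<Longrightarrow> s * Ln M X n s \<le> S"
  shows "cmod ((\<Sum>k\<in>{1..n}. char_dev k t) + t^2 / 2)
    \<le> \<bar>t\<bar>^3 / 6 * \<bar>Mn M X n z\<bar> + t^4 / 24 * (2 * z * S - z^2 * Ln M X n z) + varkappa * t^2 * Ln M X n z"
proof -
  let ?c = "\<lambda>k. expectation (\<lambda>\<omega>. if \<bar>X k \<omega>\<bar> < z then (X k \<omega>)^3 else 0)"
  let ?q = "\<lambda>k. expectation (\<lambda>\<omega>. (X k \<omega>)^2 * min ((X k \<omega>)^2) (z^2))"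
  let ?I = "\<i> * complex_of_real (t^3 / 6 * Mn M X n z)"
  have "(\<Sum>k\<in>{1..n}. char_dev k t + t^2 * sigma2 k / 2 + \<i> * complex_of_real (t^3 / 6 * ?c k))
    = (\<Sum>k\<in>{1..n}. char_dev k t) + complex_of_real (t^2 / 2 * (\<Sum>k\<in>{1..n}. sigma2 k)) + ?I"
    by (simp add: sum.distrib Mn_def sum_distrib_left)
  then have eq: "(\<Sum>k\<in>{1..n}. char_dev k t) + t^2 / 2
    = (\<Sum>k\<in>{1..n}. char_dev k t + t^2 * sigma2 k / 2 + \<i> * complex_of_real (t^3 / 6 * ?c k)) - ?I"
    unfolding sigma2_sum by simp
  have "cmod ((\<Sum>k\<in>{1..n}. char_dev k t) + t^2 / 2)
    \<le> cmod (\<Sum>k\<in>{1..n}. char_dev k t + t^2 * sigma2 k / 2 + \<i> * complex_of_real (t^3 / 6 * ?c k)) + cmod ?I"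
    unfolding eq by (rule norm_triangle_ineq4)
  also have "cmod ?I = \<bar>t\<bar>^3 / 6 * \<bar>Mn M X n z\<bar>"
    by (simp add: norm_mult norm_power norm_divide)
  also have "cmod (\<Sum>k\<in>{1..n}. char_dev k t + t^2 * sigma2 k / 2 + \<i> * complex_of_real (t^3 / 6 * ?c k))
    \<le> (\<Sum>k\<in>{1..n}. t^4 / 24 * (?q k - z^2 * tail2 k z) + varkappa * t^2 * tail2 k z)"
    by (intro sum_norm_le char_dev_cubic z)
  also have "\<dots> = t^4 / 24 * ((\<Sum>k\<in>{1..n}. ?q k) - z^2 * Ln M X n z) + varkappa * t^2 * Ln M X n z"
    by (simp add: sum.distrib sum_subtractf sum_distrib_left Ln_eq right_diff_distrib)
  also have "(\<Sum>k\<in>{1..n}. ?q k) \<le> 2 * z * S"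
    by (rule sum_sq_min_le[OF z tl])
  finally show ?thesis by (simp add: mult_left_mono)
qed

text \<open>Common to both cases: p stands for any bound on the linearised exponent. The product
  equals exp W times the Gaussian factor, and |W| is at most the linear part plus the logarithmic
  corrections.\<close>

lemma rn_le_rhs1:
  assumes e: "e > 0" and L: "L > 0" and t: "L * \<bar>t\<bar> < tau0 e"
    and tl: "\<And>z. 0 < z \<Longrightarrow> ereal z \<le> e \<Longrightarrow> z * Ln M X n z \<le> L^3"
    and p: "cmod ((\<Sum>k\<in>{1..n}. char_dev k t) + t^2 / 2) \<le> L^3 * p"
  shows "rn M X n t \<le> rhs1 L e p t"
proof -
  define y where "y = alpha e * (L * \<bar>t\<bar>)^2 / 2"
  have y: "0 \<le> y" "y < 1"
    using less_tau0D[OF e _ t] alpha_pos[OF e] L by (auto simp: y_def)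
  have x_le: "t^2 * sigma2 k / 2 \<le> y" if "k \<in> {1..n}" for k
  proof -
    have "t^2 * sigma2 k \<le> t^2 * (alpha e * L^2)"
      by (intro mult_left_mono sigma2_le_alpha[OF e L that tl]) auto
    then show ?thesis by (simp add: y_def power_mult_distrib mult_ac)
  qed
  have d1: "cmod (char_dev k t) < 1" if "k \<in> {1..n}" for k
    using norm_char_dev_le[OF that, of t] x_le[OF that] y by linarith
  define W where "W = (\<Sum>k\<in>{1..n}. ln (1 + char_dev k t)) + t^2 / 2"
  have "fbar M X n t = (\<Prod>k\<in>{1..n}. 1 + char_dev k t)"
    by (simp add: fbar_def char_dev_def)
  also have "\<dots> = (\<Prod>k\<in>{1..n}. exp (ln (1 + char_dev k t)))"
  proof (intro prod.cong refl exp_Ln[symmetric] notI)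
    fix k assume k: "k \<in> {1..n}" "1 + char_dev k t = 0"
    then have "char_dev k t = -1" by (simp add: add_eq_0_iff)
    then show False using d1[OF k(1)] by simp
  qed
  \<comment> \<open>Only the exponential of the sum of principal logarithms enters, so branches
    cause no difficulty.\<close>
  also have "\<dots> = exp W * exp (complex_of_real (- (t^2) / 2))"
    unfolding exp_add[symmetric] W_def by (simp add: exp_sum)
  also have "exp (complex_of_real (- (t^2) / 2)) = complex_of_real (exp (- (t^2) / 2))"
    by (rule exp_of_real)
  finally have fb: "fbar M X n t = exp W * exp (- (t^2) / 2)" .
  have "rn M X n t = cmod ((exp W - 1) * exp (- (t^2) / 2))"
    unfolding rn_def fb by (simp add: algebra_simps)
  also have "\<dots> = cmod (exp W - 1) * exp (- (t^2) / 2)"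
    by (simp add: norm_mult)
  also have "\<dots> \<le> (exp (cmod W) - 1) * exp (- (t^2) / 2)"
    by (intro mult_right_mono norm_exp_minus_1_le) auto
  also have "cmod W \<le> L^3 * p + L^4 * t^4 * B3 (L * \<bar>t\<bar>) e L"
  proof -
    have "W = ((\<Sum>k\<in>{1..n}. char_dev k t) + t^2 / 2) + (\<Sum>k\<in>{1..n}. ln (1 + char_dev k t) - char_dev k t)"
      by (simp add: W_def sum_subtractf)
    then have "cmod W \<le> L^3 * p + cmod (\<Sum>k\<in>{1..n}. ln (1 + char_dev k t) - char_dev k t)"
      using norm_triangle_le[OF add_right_mono[OF p]] by (metis norm_triangle_mono order_refl p)
    also have "cmod (\<Sum>k\<in>{1..n}. ln (1 + char_dev k t) - char_dev k t) \<le> (\<Sum>k\<in>{1..n}. log_rem (t^2 * sigma2 k / 2))"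
    proof (intro sum_norm_le)
      fix k assume k: "k \<in> {1..n}"
      have "cmod (ln (1 + char_dev k t) - char_dev k t) \<le> log_rem (cmod (char_dev k t))"
        by (rule norm_ln_minus_le_log_rem[OF d1[OF k]])
      also have "\<dots> \<le> log_rem (t^2 * sigma2 k / 2)"
        using norm_char_dev_le[OF k, of t] x_le[OF k] y by (intro log_rem_mono) auto
      finally show "cmod (ln (1 + char_dev k t) - char_dev k t) \<le> log_rem (t^2 * sigma2 k / 2)" .
    qed
    also have "(\<Sum>k\<in>{1..n}. log_rem (t^2 * sigma2 k / 2)) \<le> 4 * alpha1 e L / (alpha e)^2 * log_rem y"
    proof (cases "t = 0")
      case False
      then have y0: "y > 0" using alpha_pos[OF e] L by (simp add: y_def)
      \<comment> \<open>All arguments are at most the common y, so \<open>log_rem_scale\<close>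
        compares each term with its square and leaves the sum of the squared variances.\<close>
      have "(\<Sum>k\<in>{1..n}. log_rem (t^2 * sigma2 k / 2)) \<le> (\<Sum>k\<in>{1..n}. (t^2 * sigma2 k / 2)^2 * (log_rem y / y^2))"
      proof (rule sum_mono)
        fix k assume k: "k \<in> {1..n}"
        show "log_rem (t^2 * sigma2 k / 2) \<le> (t^2 * sigma2 k / 2)^2 * (log_rem y / y^2)"
          using log_rem_scale[OF _ x_le[OF k] y(2)] sigma2_nonneg[of k] y0
          by (simp add: pos_le_divide_eq)
      qed
      also have "\<dots> = (\<Sum>k\<in>{1..n}. (sigma2 k)^2) * (t^4 / 4 * (log_rem y / y^2))"
        unfolding sum_distrib_right
        by (intro sum.cong) (simp_all add: power_mult_distrib power_divide power_mult[symmetric])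
      also have "\<dots> \<le> (4 * alpha1 e L * L^4) * (t^4 / 4 * (log_rem y / y^2))"
        using log_rem_nonneg[OF y]
        by (intro mult_right_mono sum_sigma2_sq_le_alpha1[OF e L tl]) auto
      also have "y^2 = (alpha e)^2 * L^4 * t^4 / 4"
        by (simp add: y_def power_mult_distrib power_divide power_mult[symmetric])
      also have "(4 * alpha1 e L * L^4) * (t^4 / 4 * (log_rem y / ((alpha e)^2 * L^4 * t^4 / 4)))
        = 4 * alpha1 e L / (alpha e)^2 * log_rem y"
        using False L alpha_pos[OF e] by (simp add: field_simps)
      finally show ?thesis .
    qed (simp add: y_def)
    finally show ?thesis unfolding B3_scaled[OF L] y_def by simp
  qed
  finally show ?thesis unfolding rhs1_def by simp
qed

end

section \<open>The Esseen and Rozovskii fractions\<close>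

text \<open>The coefficient b may be negative; a >= 0 keeps the maximum nonnegative in the last
  step.\<close>

lemma add_le_max_mult:
  fixes a b g h c :: real
  assumes "0 \<le> a" "0 \<le> g" "0 \<le> h" "g + h \<le> c"
  shows "a * g + b * h \<le> max a b * c"
proof -
  have "a * g + b * h \<le> max a b * g + max a b * h"
    using assms by (intro add_mono mult_right_mono) auto
  also have "\<dots> = max a b * (g + h)" by (simp add: algebra_simps)
  also have "\<dots> \<le> max a b * c" using assms by (intro mult_left_mono) (auto simp: le_max_iff_disj)
  finally show ?thesis .
qed

context unit_variance_sum
begin

lemma LE3_ge:
  assumes "LE3 M X n e \<gamma> = ereal c" "0 < z" "ereal z \<le> e"
  shows "\<gamma> * \<bar>Mn M X n z\<bar> + z * Ln M X n z \<le> c"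
proof -
  have "ereal (\<gamma> * \<bar>Mn M X n z\<bar> + z * Ln M X n z) \<le> LE3 M X n e \<gamma>"
    unfolding LE3_def using assms by (intro SUP_upper) auto
  then show ?thesis using assms by simp
qed

text \<open>At each level z the Esseen fraction bounds gamma |M_n(z)| and z L_n(z) jointly, so their
  coefficients are replaced by the larger one. The infimum over z is \<open>p_E\<close>.\<close>

lemma sum_char_dev_le_p_E:
  assumes g: "\<gamma> > 0" and e: "e > 0" and L: "L > 0" and LE: "LE3 M X n e \<gamma> = ereal (L^3)"
  shows "cmod ((\<Sum>k\<in>{1..n}. char_dev k t) + t^2 / 2) \<le> L^3 * p_E t e \<gamma>"
proof -
  have "cmod ((\<Sum>k\<in>{1..n}. char_dev k t) + t^2 / 2) / L^3 \<le> p_E t e \<gamma>"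
  proof (rule p_E_ge[OF e])
    fix z assume z: "0 < z" "ereal z \<le> e"
    let ?a = "\<bar>t\<bar> / (6*\<gamma>)" and ?b = "varkappa / z - z * t^2 / 24"
    let ?m = "\<bar>Mn M X n z\<bar>" and ?l = "Ln M X n z"
    have tl: "s * Ln M X n s \<le> L^3" if "0 < s" "s \<le> z" for s
    proof -
      have "ereal s \<le> e" using that z(2) by (meson ereal_less_eq(3) order_trans)
      moreover have "0 \<le> \<gamma> * \<bar>Mn M X n s\<bar>" using g by simp
      ultimately show ?thesis using LE3_ge[OF LE that(1)] by linarith
    qed
    have "cmod ((\<Sum>k\<in>{1..n}. char_dev k t) + t^2 / 2)
      \<le> \<bar>t\<bar>^3 / 6 * ?m + t^4 / 24 * (2 * z * L^3 - z^2 * ?l) + varkappa * t^2 * ?l"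
      by (rule sum_char_dev_le[OF z(1) tl])
    also have "\<dots> = t^2 * (z * t^2 / 12 * L^3 + (?a * (\<gamma> * ?m) + ?b * (z * ?l)))"
    proof -
      have "\<bar>t\<bar>^3 = t^2 * \<bar>t\<bar>" "t^4 = t^2 * t^2"
        by (simp_all add: power3_eq_cube power2_eq_square eval_nat_numeral)
      then show ?thesis using g z by (simp add: field_simps power2_eq_square)
    qed
    also have "\<dots> \<le> t^2 * (z * t^2 / 12 * L^3 + max ?a ?b * L^3)"
      using g z Ln_nonneg LE3_ge[OF LE z]
      by (intro mult_left_mono add_left_mono add_le_max_mult) auto
    finally show "cmod ((\<Sum>k\<in>{1..n}. char_dev k t) + t^2 / 2) / L^3 \<le> t^2 * (z * t^2 / 12 + max ?a ?b)"
      using L by (simp add: field_simps)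
  qed
  then show ?thesis using L by (simp add: field_simps)
qed

lemma rn_le_Esseen:
  assumes g: "\<gamma> > 0" and e: "e > 0" and L: "L > 0" and LE: "LE3 M X n e \<gamma> = ereal (L^3)"
    and t: "L * \<bar>t\<bar> < tau0 e"
  shows "rn M X n t \<le> rhs1 L e (p_E t e \<gamma>) t"
proof (rule rn_le_rhs1[OF e L t])
  fix z assume z: "0 < z" "ereal z \<le> e"
  have "0 \<le> \<gamma> * \<bar>Mn M X n z\<bar>" using g by simp
  then show "z * Ln M X n z \<le> L^3" using LE3_ge[OF LE z] by linarith
qed (rule sum_char_dev_le_p_E[OF g e L LE])

text \<open>Here |M_n| is controlled only at z = e, so the expansion is used at that level alone.
  The fraction splits exactly as gamma |M_n(e)| + S.\<close>

lemma rn_le_Rozovskii: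
  assumes g: "\<gamma> > 0" and e: "e > 0" and L: "L > 0" and LR: "LR3 M X n e \<gamma> = L^3"
    and t: "L * \<bar>t\<bar> < tau0 (ereal e)"
  shows "rn M X n t \<le> rhs1 L (ereal e) (p_R t e \<gamma>) t"
proof -
  define S where "S = (SUP z\<in>{0<..e}. z * Ln M X n z)"
  have tl: "z * Ln M X n z \<le> S" if "0 < z" "z \<le> e" for z
    unfolding S_def
  proof (rule cSUP_upper)
    show "bdd_above ((\<lambda>z. z * Ln M X n z) ` {0<..e})"
    proof (rule bdd_aboveI2)
      fix z assume "z \<in> {0<..e}"
      then show "z * Ln M X n z \<le> e * 1" using Ln_le_1 Ln_nonneg e by (intro mult_mono) auto
    qed
  qed (use that in auto)
  let ?m = "\<bar>Mn M X n e\<bar>" and ?l = "Ln M X n e"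
  have LS: "\<gamma> * ?m + S = L^3" using LR by (simp add: LR3_def S_def)
  have lS: "0 \<le> e * ?l" "e * ?l \<le> S" using tl[of e] e Ln_nonneg by auto
  let ?a = "\<bar>t\<bar> / (6*\<gamma>)" and ?b = "varkappa / e - e * t^2 / 24"
    and ?c = "max (varkappa / e + e * t^2 / 24) (e * t^2 / 12)"
  show ?thesis
  proof (rule rn_le_rhs1[OF _ L t])
    fix z assume z: "0 < z" "ereal z \<le> ereal e"
    have "0 \<le> \<gamma> * ?m" using g by simp
    then show "z * Ln M X n z \<le> L^3" using tl[of z] z LS by simp
  next
    have "cmod ((\<Sum>k\<in>{1..n}. char_dev k t) + t^2 / 2)
      \<le> \<bar>t\<bar>^3 / 6 * ?m + t^4 / 24 * (2 * e * S - e^2 * ?l) + varkappa * t^2 * ?l"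
      by (rule sum_char_dev_le[OF e tl])
    also have "\<dots> = t^2 * (?a * (\<gamma> * ?m) + (e * t^2 / 12 * S + ?b * (e * ?l)))"
    proof -
      have "\<bar>t\<bar>^3 = t^2 * \<bar>t\<bar>" "t^4 = t^2 * t^2"
        by (simp_all add: power3_eq_cube power2_eq_square eval_nat_numeral)
      then show ?thesis using g e by (simp add: field_simps power2_eq_square)
    qed
    also have "\<dots> \<le> t^2 * (?a * (\<gamma> * ?m) + ?c * S)"
    proof -
      \<comment> \<open>Since \<open>?b\<close> may be negative, its positive part is needed before
        e L_n(e) can be enlarged to S.\<close>
      have "?b * (e * ?l) \<le> max 0 ?b * S"
        using lS by (intro mult_mono) auto
      then have "e * t^2 / 12 * S + ?b * (e * ?l) \<le> (e * t^2 / 12 + max 0 ?b) * S"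
        by (simp add: algebra_simps)
      \<comment> \<open>Applied with x = e t^2/12 and y = kappa/e, this gives the last two entries
        of the maximum in \<open>p_R\<close>.\<close>
      also have "x + max 0 (y - x / 2) = max (y + x / 2) x" for x y :: real
        by (auto simp: max_def)
      from this[of "e * t^2 / 12" "varkappa / e"]
      have "e * t^2 / 12 + max 0 ?b = ?c" by simp
      finally show ?thesis by (intro mult_left_mono add_left_mono) auto
    qed
    also have "\<dots> \<le> t^2 * (max ?a ?c * L^3)"
      using g lS LS by (intro mult_left_mono add_le_max_mult) auto
    finally show "cmod ((\<Sum>k\<in>{1..n}. char_dev k t) + t^2 / 2) \<le> L^3 * p_R t e \<gamma>"
      by (simp add: p_R_def mult_ac)
  qed (use e in simp)
qed

end

theorem theorem5:
  fixes M :: "'a measure" and X :: "nat \<Rightarrow> 'a \<Rightarrow> real" and n :: nat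
  assumes "prob_space M"
    and "prob_space.indep_vars M (\<lambda>_. borel) X {1..n}"
    and "\<And>k. k \<in> {1..n} \<Longrightarrow> X k \<in> borel_measurable M"
    and "\<And>k. k \<in> {1..n} \<Longrightarrow> integrable M (\<lambda>\<omega>. (X k \<omega>)^2)"
    and "\<And>k. k \<in> {1..n} \<Longrightarrow> (LINT \<omega>|M. X k \<omega>) = 0"
    and "(\<Sum>k\<in>{1..n}. LINT \<omega>|M. (X k \<omega>)^2) = 1"
  shows
  \<comment> \<open>(i), Esseen case\<close>
  "(\<forall>\<gamma> e L t. \<gamma> > 0 \<and> e > 0 \<and> L > 0 \<and> LE3 M X n e \<gamma> = ereal (L^3) \<and> L * \<bar>t\<bar> < tau0 e
      \<longrightarrow> rn M X n t \<le> rhs1 L e (p_E t e \<gamma>) t)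
 \<and>
  \<comment> \<open>(i), Rozovskii case\<close>
   (\<forall>\<gamma> e L t. \<gamma> > 0 \<and> e > 0 \<and> L > 0 \<and> LR3 M X n e \<gamma> = L^3 \<and> L * \<bar>t\<bar> < tau0 (ereal e)
      \<longrightarrow> rn M X n t \<le> rhs1 L (ereal e) (p_R t e \<gamma>) t)
 \<and>
  \<comment> \<open>(i), special case eps = infinity\<close>
   (\<forall>\<gamma> L t. \<gamma> > 0 \<and> L > 0 \<and> LE3 M X n \<infinity> \<gamma> = ereal (L^3) \<and> L * \<bar>t\<bar> < 2 powr (5/6) / sqrt 3
      \<longrightarrow> rn M X n t \<le>
        (exp (sqrt (6 * varkappa * \<gamma>^2 + 1) / (6*\<gamma>) * L^3 * \<bar>t\<bar>^3
              - 4 * sqrt 2 * 3 powr (-3/2) *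
                (ln (1 - 3 * 2 powr (-5/3) * L^2 * t^2) + 3 * 2 powr (-5/3) * L^2 * t^2)) - 1)
        * exp (- (t^2) / 2))
 \<and>
  \<comment> \<open>(i), monotonicity of the right-hand side\<close>
   (\<forall>\<gamma> e L1 L2 t. \<gamma> > 0 \<and> e > 0 \<and> 0 < L1 \<and> L1 \<le> L2 \<and> L2 * \<bar>t\<bar> < tau0 e
      \<longrightarrow> rhs1 L1 e (p_E t e \<gamma>) t \<le> rhs1 L2 e (p_E t e \<gamma>) t)
 \<and> (\<forall>\<gamma> e L1 L2 t. \<gamma> > 0 \<and> e > 0 \<and> 0 < L1 \<and> L1 \<le> L2 \<and> L2 * \<bar>t\<bar> < tau0 (ereal e)
      \<longrightarrow> rhs1 L1 (ereal e) (p_R t e \<gamma>) t \<le> rhs1 L2 (ereal e) (p_R t e \<gamma>) t)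
 \<and> (\<forall>\<gamma>1 \<gamma>2 e L t. 0 < \<gamma>1 \<and> \<gamma>1 \<le> \<gamma>2 \<and> e > 0 \<and> L > 0 \<and> L * \<bar>t\<bar> < tau0 e
      \<longrightarrow> rhs1 L e (p_E t e \<gamma>2) t \<le> rhs1 L e (p_E t e \<gamma>1) t)
 \<and> (\<forall>\<gamma>1 \<gamma>2 e L t. 0 < \<gamma>1 \<and> \<gamma>1 \<le> \<gamma>2 \<and> e > 0 \<and> L > 0 \<and> L * \<bar>t\<bar> < tau0 (ereal e)
      \<longrightarrow> rhs1 L (ereal e) (p_R t e \<gamma>2) t \<le> rhs1 L (ereal e) (p_R t e \<gamma>1) t)
 \<and> (\<forall>\<gamma> e1 e2 L t. \<gamma> > 0 \<and> 0 < e1 \<and> e1 \<le> e2 \<and> L > 0 \<and> L * \<bar>t\<bar> < tau0 e1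
      \<longrightarrow> rhs1 L e2 (p_E t e2 \<gamma>) t \<le> rhs1 L e1 (p_E t e1 \<gamma>) t)
 \<and> (\<forall>\<gamma>1 \<gamma>2 e L t. gamma_star \<le> \<gamma>1 \<and> gamma_star \<le> \<gamma>2 \<and> e > 0 \<and> L > 0
      \<longrightarrow> rhs1 L (ereal e) (p_R t e \<gamma>1) t = rhs1 L (ereal e) (p_R t e \<gamma>2) t)
 \<and>
  \<comment> \<open>(ii), Esseen case\<close>
   (\<forall>\<gamma> e L \<tau> t. \<gamma> > 0 \<and> e > 0 \<and> L > 0 \<and> LE3 M X n e \<gamma> = ereal (L^3) \<and> ereal L \<le> Lbar0 e
       \<and> L * \<bar>t\<bar> < \<tau> \<and> \<tau> < tau0 e
      \<longrightarrow> rn M X n t \<le> rhsE2 \<tau> e \<gamma> L t)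
 \<and>
  \<comment> \<open>(ii), Esseen case, eps = infinity\<close>
   (\<forall>\<gamma> L \<tau> t. \<gamma> > 0 \<and> L > 0 \<and> LE3 M X n \<infinity> \<gamma> = ereal (L^3)
       \<and> L * \<bar>t\<bar> < \<tau> \<and> \<tau> < 2 powr (5/6) / sqrt 3
      \<longrightarrow> rn M X n t \<le>
        exp (\<tau>^3 / (6*\<gamma>) + sqrt (varkappa / 6) * \<tau>^3
             + \<tau>^4 * (sqrt 3 * 2 powr (-1/6) / (2 powr (5/3) - 3 * \<tau>^2)))
        * (sqrt (6 * varkappa * \<gamma>^2 + 1) / (6*\<gamma>)
           + (sqrt 3 * 2 powr (-1/6) / (2 powr (5/3) - 3 * \<tau>^2)) * L * \<bar>t\<bar>)
        * L^3 * \<bar>t\<bar>^3 * exp (- (t^2) / 2))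
 \<and>
  \<comment> \<open>(ii), Esseen case: monotonicity\<close>
   (\<forall>\<gamma> e L1 L2 \<tau> t. \<gamma> > 0 \<and> e > 0 \<and> 0 < L1 \<and> L1 \<le> L2 \<and> 0 < \<tau> \<and> \<tau> < tau0 e
      \<longrightarrow> rhsE2 \<tau> e \<gamma> L1 t \<le> rhsE2 \<tau> e \<gamma> L2 t)
 \<and> (\<forall>\<gamma> e1 e2 L \<tau> t. \<gamma> > 0 \<and> 0 < e1 \<and> e1 \<le> e2 \<and> L > 0 \<and> 0 < \<tau> \<and> \<tau> < tau0 e1
      \<longrightarrow> rhsE2 \<tau> e2 \<gamma> L t \<le> rhsE2 \<tau> e1 \<gamma> L t)
 \<and> (\<forall>\<gamma>1 \<gamma>2 e L \<tau> t. 0 < \<gamma>1 \<and> \<gamma>1 \<le> \<gamma>2 \<and> e > 0 \<and> L > 0 \<and> 0 < \<tau> \<and> \<tau> < tau0 e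
      \<longrightarrow> rhsE2 \<tau> e \<gamma>2 L t \<le> rhsE2 \<tau> e \<gamma>1 L t)
 \<and>
  \<comment> \<open>(ii), Rozovskii case\<close>
   (\<forall>\<gamma> e L \<tau> t. \<gamma> > 0 \<and> e > 0 \<and> L > 0 \<and> LR3 M X n e \<gamma> = L^3 \<and> ereal L \<le> Lbar0 (ereal e)
       \<and> L * \<bar>t\<bar> < \<tau> \<and> \<tau> < tau0 (ereal e)
      \<longrightarrow> rn M X n t \<le> rhsR2 \<tau> e \<gamma> L t)
 \<and> (\<forall>e L. e > 0 \<and> L > 0 \<longrightarrow>
      ((\<forall>\<tau>. 0 < \<tau> \<and> \<tau> < tau0 (ereal e) \<longrightarrow> hfun \<tau> e L > 0) \<longleftrightarrow> L \<le> 6 / (e * (tau0 (ereal e))^2)))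
 \<and> (\<forall>\<gamma> e L1 L2 \<tau> t. \<gamma> > 0 \<and> e > 0 \<and> 0 < L1 \<and> L1 \<le> L2 \<and> 0 < \<tau> \<and> \<tau> < tau0 (ereal e)
      \<longrightarrow> rhsR2 \<tau> e \<gamma> L1 t \<le> rhsR2 \<tau> e \<gamma> L2 t)
 \<and> (\<forall>\<gamma>1 \<gamma>2 e L \<tau> t. 0 < \<gamma>1 \<and> \<gamma>1 \<le> \<gamma>2 \<and> e > 0 \<and> L > 0 \<and> 0 < \<tau> \<and> \<tau> < tau0 (ereal e)
      \<longrightarrow> rhsR2 \<tau> e \<gamma>2 L t \<le> rhsR2 \<tau> e \<gamma>1 L t)"
proof -
  interpret unit_variance_sum M X n
    using assms unfolding unit_variance_sum_def unit_variance_sum_axioms_def by blast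
  show ?thesis
    apply (intro conjI allI impI; elim conjE)
    subgoal by (rule rn_le_Esseen)
    subgoal by (rule rn_le_Rozovskii)
    subgoal for \<gamma> L t
      by (rule order_trans[OF rn_le_Esseen[of \<gamma> \<infinity>] rhs1_infinity_le]) (simp_all add: tau0_infinity)
    subgoal by (intro rhs1_mono_L p_E_nonneg)
    subgoal by (intro rhs1_mono_L p_R_nonneg) simp_all
    subgoal by (intro rhs1_mono_p p_E_antimono_gamma)
    subgoal by (intro rhs1_mono_p p_R_antimono_gamma)
    subgoal by (intro rhs1_mono mult_left_mono p_E_antimono_eps B3_term_mono) simp_all
    subgoal by (simp add: p_R_gamma_star)
    subgoal for \<gamma> e L \<tau> t
      by (rule order_trans[OF rn_le_Esseen[of \<gamma> e] rhs1_le_rhsE2]) simp_all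
    subgoal for \<gamma> L \<tau> t
      by (rule order_trans[OF rn_le_Esseen[of \<gamma> \<infinity>] rhs1_infinity_le_product])
         (simp_all add: tau0_infinity)
    subgoal by (rule rhsE2_mono) simp_all
    subgoal by (rule rhsE2_mono) simp_all
    subgoal by (rule rhsE2_mono) simp_all
    subgoal for \<gamma> e L \<tau> t
      by (rule order_trans[OF rn_le_Rozovskii[of \<gamma> e] rhs1_le_rhsR2]) simp_all
    subgoal by (rule hfun_pos_iff)
    subgoal by (rule rhsR2_mono) simp_all
    subgoal by (rule rhsR2_mono) simp_all
    done
qed

end
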